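(* Let $d,m$ be positive integers, let $\Gamma$ be a closed subgroup of $\mathrm{E}(d)$ that contains $\mathbb{R}^d$ (the translations), let $\Gamma_0$ be the isotropy group of $0$ in $\Gamma$, and let $\phi\colon\Gamma_0\to GL_m(\mathbb{C})$ be a group homomorphism. Assume that at least one of the following holds: (i) there is $v\in\mathbb{C}^m\setminus\{0\}$ such that $\phi(\gamma)v=v$ for each $\gamma\in\Gamma_0$; (ii) $\Gamma_0$ is finite. Let $\Pi$ and $\Pi'$ be glueable abstract pattern spaces over $(\mathbb{R}^d,\Gamma)$ and let $\mathcal{P}\in\Pi$, $\mathcal{P}'\in\Pi'$ be both Delone-deriving and both consisting of bounded components. Set $\Sigma=C^{\infty}_{\phi\circ\pi}(\mathbb{R}^d,\mathbb{C}^m,0)$, and for an abstract pattern $\mathcal{Q}$ let $\Sigma_{\mathcal{Q}}=\{f\in\Sigma\mid f\text{ is locally derivable from }\mathcal{Q}\}$. Then $\mathcal{P}$ and $\mathcal{P}'$ are mutually locally derivable if and only if $\Sigma_{\mathcal{P}}=\Sigma_{\mathcal{P}'}$.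
   Context: Conventions: $\mathbb{R}^d$ carries the Euclidean metric $\rho$; $B(x,r)$ is the closed ball; $\mathrm{E}(d)\cong\mathbb{R}^d\rtimes\mathrm{O}(d)$ is the isometry group of $\mathbb{R}^d$, its elements written as pairs $(a,A)$, $a\in\mathbb{R}^d$, $A\in\mathrm{O}(d)$; $\pi\colon\Gamma\ni(a,A)\mapsto A\in\Gamma_0$ is the projection. $\mathrm{Cl}(X)$ is the set of closed subsets of $X$. Abstract pattern space: an abstract pattern space over a topological space $X$ is a non-empty set $\Pi$ with a map $\Pi\times\mathrm{Cl}(X)\to\Pi$, $(\mathcal{P},C)\mapsto\mathcal{P}\wedge C$ such that (1) $(\mathcal{P}\wedge C_1)\wedge C_2=\mathcal{P}\wedge(C_1\cap C_2)$ always; (2) for each $\mathcal{P}\in\Pi$ there is a (unique) closed set $\operatorname{supp}\mathcal{P}$ with $\mathcal{P}\wedge C=\mathcal{P}\iff C\supset\operatorname{supp}\mathcal{P}$ for all $C\in\mathrm{Cl}(X)$. If $\Gamma$ acts on $X$ by homeomorphisms, it is an abstract pattern space over $(X,\Gamma)$ if moreover $\Gamma$ acts on $\Pi$ with $(\gamma\mathcal{P})\wedge(\gamma C)=\gamma(\mathcal{P}\wedge C)$ always. A subshift is a non-empty $\Gamma$-invariant subset. Function space: $\mathrm{Map}_{\phi\circ\pi}(\mathbb{R}^d,\mathbb{C}^m,0)$ is the set of all maps $f\colon\mathbb{R}^d\to\mathbb{C}^m$ with $(f\wedge C)(x)=f(x)$ if $x\in C$ and $0$ otherwise, and $\Gamma$-action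 $(\gamma f)(x)=\phi(\pi(\gamma))(f(\gamma^{-1}x))$; it is an abstract pattern space over $(\mathbb{R}^d,\Gamma)$. $C^{\infty}_{\phi\circ\pi}(\mathbb{R}^d,\mathbb{C}^m,0)$ is the subshift of its smooth elements ($f$ is smooth if $\langle f(\cdot),v\rangle$ is smooth for every $v\in\mathbb{C}^m$). Glueing ($X$ a metric space): $\mathcal{P}\geqq\mathcal{Q}$ means $\mathcal{P}\wedge\operatorname{supp}\mathcal{Q}=\mathcal{Q}$; this is a partial order, and $\bigvee\Xi$ denotes the supremum. $\Xi\wedge C=\{\mathcal{P}\wedge C\mid\mathcal{P}\in\Xi\}$. $\mathcal{P},\mathcal{Q}$ are compatible if some $\mathcal{R}\in\Pi$ satisfies $\mathcal{R}\geqq\mathcal{P}$ and $\mathcal{R}\geqq\mathcal{Q}$. $\Xi\subset\Pi$ is pairwise compatible if any two of its elements are compatible, and locally finite if $\Xi\wedge B(x,r)$ is finite for all $x\in X$, $r>0$. $\Pi$ is glueable if every locally finite and pairwise compatible $\Xi\subset\Pi$ has a supremum and $\bigvee(\Xi\wedge C)=(\bigvee\Xi)\wedge C$ for all $C\in\mathrm{Cl}(X)$. Bounded components: $\mathcal{P}$ consists of bounded components if there is $R_{\mathcal P}>0$ such that for every closed $C$ and $x\in\operatorname{supp}(\mathcal{P}\wedge C)$ we have $x\in\operatorname{supp}(\mathcal{P}\wedge C\wedge B(x,R_{\mathcal P}))$. Local derivability: for abstract patterns $\mathcal{P}_1,\mathcal{P}_2$ in abstract pattern spaces over $(X,\Gamma)$,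 $(Y,\Gamma)$ ($\Gamma$ acting by isometries on proper metric spaces), $\mathcal{P}_2$ is locally derivable from $\mathcal{P}_1$ if there are $x_0\in X$, $y_0\in Y$, $R_0\geqq0$ such that for all $\gamma,\eta\in\Gamma$, $R\geqq0$: $(\gamma\mathcal{P}_1)\wedge B(x_0,R+R_0)=(\eta\mathcal{P}_1)\wedge B(x_0,R+R_0)$ implies $(\gamma\mathcal{P}_2)\wedge B(y_0,R)=(\eta\mathcal{P}_2)\wedge B(y_0,R)$. They are mutually locally derivable if each is locally derivable from the other. Delone sets: $D\subset X$ is uniformly discrete if for some $r>0$, $\rho(x,y)>r$ for all distinct $x,y\in D$; relatively dense if for some $R>0$, $D$ meets the interior of $B(x,R)$ for every $x\in X$; Delone if both. The set $\mathrm{UD}(X)$ of uniformly discrete subsets is an abstract pattern space over $(X,\Gamma)$ with $D\wedge C=D\cap C$ and $\gamma D=\{\gamma x\mid x\in D\}$. $\mathcal{P}$ is Delone-deriving if some Delone set $D$ in $X$ (viewed in $\mathrm{UD}(X)$) is locally derivable from $\mathcal{P}$. *)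

theory Defs
  imports "HOL-Analysis.Analysis" "HOL-Algebra.Group_Action"
begin

section \<open>Abstract pattern spaces\<close>

text \<open>A pattern space is a carrier set (of patterns) together with the cutting-off operation,
  \<open>cut S P C\<close> being written $P \wedge C$ on paper, and an action of a group with elements of
  type \<open>'g\<close>.\<close>

record ('p, 'x, 'g) pattern_space = "'p partial_object" +
  cut :: "'p \<Rightarrow> 'x set \<Rightarrow> 'p"
  act :: "'g \<Rightarrow> 'p \<Rightarrow> 'p"

locale abstract_pattern_space =
  fixes S :: "('p, 'x::topological_space, 'g) pattern_space"
  assumes nonempty: "carrier S \<noteq> {}"
    and cut_closed: "\<lbrakk>P \<in> carrier S; closed C\<rbrakk> \<Longrightarrow> cut S P C \<in> carrier S"
    and cut_cut: "\<lbrakk>P \<in> carrier S; closed C; closed D\<rbrakk>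
                    \<Longrightarrow> cut S (cut S P C) D = cut S P (C \<inter> D)"
    and ex_supp: "P \<in> carrier S
                    \<Longrightarrow> \<exists>K. closed K \<and> (\<forall>C. closed C \<longrightarrow> (cut S P C = P \<longleftrightarrow> K \<subseteq> C))"

text \<open>In the library, a group action on a set consists of functions that are extensional on that
  set; hence the restriction in \<open>action\<close>.\<close>

locale abstract_pattern_space_over = group_action G UNIV actX + abstract_pattern_space S
  for G (structure) and actX :: "'g \<Rightarrow> 'x::topological_space \<Rightarrow> 'x"
    and S :: "('p, 'x, 'g) pattern_space" +
  assumes homeo: "g \<in> carrier G \<Longrightarrow> \<exists>h. homeomorphism UNIV UNIV (actX g) h"
    and action: "group_action G (carrier S) (\<lambda>g. restrict (act S g) (carrier S))"
    and act_cut: "\<lbrakk>g \<in> carrier G; P \<in> carrier S; closed C\<rbrakk>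
                    \<Longrightarrow> cut S (act S g P) (actX g ` C) = act S g (cut S P C)"

definition supp :: "('p, 'x::topological_space, 'g) pattern_space \<Rightarrow> 'p \<Rightarrow> 'x set" where
  "supp S P = (THE K. closed K \<and> (\<forall>C. closed C \<longrightarrow> (cut S P C = P \<longleftrightarrow> K \<subseteq> C)))"

section \<open>Glueing\<close>

text \<open>\<open>pat_ge S P Q\<close> is $P \geqq Q$.\<close>

definition pat_ge :: "('p, 'x::topological_space, 'g) pattern_space \<Rightarrow> 'p \<Rightarrow> 'p \<Rightarrow> bool" where
  "pat_ge S P Q \<longleftrightarrow> cut S P (supp S Q) = Q"

definition is_supremum ::
    "('p, 'x::topological_space, 'g) pattern_space \<Rightarrow> 'p set \<Rightarrow> 'p \<Rightarrow> bool" where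
  "is_supremum S \<Xi> P \<longleftrightarrow>
     P \<in> carrier S \<and> (\<forall>Q\<in>\<Xi>. pat_ge S P Q) \<and>
     (\<forall>R\<in>carrier S. (\<forall>Q\<in>\<Xi>. pat_ge S R Q) \<longrightarrow> pat_ge S R P)"

definition compatible :: "('p, 'x::topological_space, 'g) pattern_space \<Rightarrow> 'p \<Rightarrow> 'p \<Rightarrow> bool" where
  "compatible S P Q \<longleftrightarrow> (\<exists>R\<in>carrier S. pat_ge S R P \<and> pat_ge S R Q)"

definition pairwise_compatible ::
    "('p, 'x::topological_space, 'g) pattern_space \<Rightarrow> 'p set \<Rightarrow> bool" where
  "pairwise_compatible S \<Xi> \<longleftrightarrow> (\<forall>P\<in>\<Xi>. \<forall>Q\<in>\<Xi>. compatible S P Q)"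

definition locally_finite_patterns ::
    "('p, 'x::metric_space, 'g) pattern_space \<Rightarrow> 'p set \<Rightarrow> bool" where
  "locally_finite_patterns S \<Xi> \<longleftrightarrow> (\<forall>x. \<forall>r>0. finite ((\<lambda>P. cut S P (cball x r)) ` \<Xi>))"

text \<open>Suprema are unique, since \<open>pat_ge S\<close> is antisymmetric on \<open>carrier S\<close>. So the last conjunct
  below is the equation $\bigvee (\Xi \wedge C) = (\bigvee \Xi) \wedge C$.\<close>

definition glueable :: "('p, 'x::metric_space, 'g) pattern_space \<Rightarrow> bool" where
  "glueable S \<longleftrightarrow>
     (\<forall>\<Xi>\<subseteq>carrier S. locally_finite_patterns S \<Xi> \<and> pairwise_compatible S \<Xi> \<longrightarrow>
        (\<exists>P. is_supremum S \<Xi> P \<and>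
             (\<forall>C. closed C \<longrightarrow> is_supremum S ((\<lambda>Q. cut S Q C) ` \<Xi>) (cut S P C))))"

definition bounded_components ::
    "('p, 'x::metric_space, 'g) pattern_space \<Rightarrow> 'p \<Rightarrow> bool" where
  "bounded_components S P \<longleftrightarrow>
     (\<exists>R>0. \<forall>C. closed C \<longrightarrow>
        (\<forall>x\<in>supp S (cut S P C). x \<in> supp S (cut S (cut S P C) (cball x R))))"

section \<open>Local derivability\<close>

text \<open>\<open>locally_derivable G S P T Q\<close>: the pattern \<open>Q\<close> of \<open>T\<close> is locally derivable from the
  pattern \<open>P\<close> of \<open>S\<close>.\<close>

definition locally_derivable ::
    "('g, 'b) monoid_scheme \<Rightarrow> ('p, 'x::metric_space, 'g) pattern_space \<Rightarrow> 'p
       \<Rightarrow> ('q, 'y::metric_space, 'g) pattern_space \<Rightarrow> 'q \<Rightarrow> bool" where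
  "locally_derivable G S P T Q \<longleftrightarrow>
     (\<exists>x0 y0. \<exists>R0\<ge>0. \<forall>\<gamma>\<in>carrier G. \<forall>\<eta>\<in>carrier G. \<forall>R\<ge>0.
        cut S (act S \<gamma> P) (cball x0 (R + R0)) = cut S (act S \<eta> P) (cball x0 (R + R0)) \<longrightarrow>
        cut T (act T \<gamma> Q) (cball y0 R) = cut T (act T \<eta> Q) (cball y0 R))"

definition mutually_locally_derivable ::
    "('g, 'b) monoid_scheme \<Rightarrow> ('p, 'x::metric_space, 'g) pattern_space \<Rightarrow> 'p
       \<Rightarrow> ('q, 'y::metric_space, 'g) pattern_space \<Rightarrow> 'q \<Rightarrow> bool" where
  "mutually_locally_derivable G S P T Q \<longleftrightarrow>
     locally_derivable G S P T Q \<and> locally_derivable G T Q S P"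

section \<open>Delone sets\<close>

definition uniformly_discrete :: "'x::metric_space set \<Rightarrow> bool" where
  "uniformly_discrete D \<longleftrightarrow> (\<exists>r>0. \<forall>x\<in>D. \<forall>y\<in>D. x \<noteq> y \<longrightarrow> dist x y > r)"

definition relatively_dense :: "'x::metric_space set \<Rightarrow> bool" where
  "relatively_dense D \<longleftrightarrow> (\<exists>R>0. \<forall>x. D \<inter> interior (cball x R) \<noteq> {})"

definition delone :: "'x::metric_space set \<Rightarrow> bool" where
  "delone D \<longleftrightarrow> uniformly_discrete D \<and> relatively_dense D"

definition UD_space ::
    "('g \<Rightarrow> 'x::metric_space \<Rightarrow> 'x) \<Rightarrow> ('x set, 'x, 'g) pattern_space" where
  "UD_space actX = \<lparr>carrier = {D. uniformly_discrete D}, cut = (\<inter>), act = (\<lambda>g D. actX g ` D)\<rparr>"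

definition delone_deriving ::
    "('g, 'b) monoid_scheme \<Rightarrow> ('g \<Rightarrow> 'x::metric_space \<Rightarrow> 'x)
       \<Rightarrow> ('p, 'x, 'g) pattern_space \<Rightarrow> 'p \<Rightarrow> bool" where
  "delone_deriving G actX S P \<longleftrightarrow>
     (\<exists>D. delone D \<and> locally_derivable G S P (UD_space actX) D)"

section \<open>The Euclidean group\<close>

text \<open>The isometry $x \mapsto a + A x$ is the pair \<open>(a, A)\<close>. As $\mathrm{O}(d)$ is closed in the
  space of matrices, a set of such pairs is closed in $\mathbb{R}^d \rtimes \mathrm{O}(d)$ iff it is
  closed in the product type.\<close>

type_synonym 'd isom = "(real ^ 'd) \<times> (real ^ 'd ^ 'd)"

definition euclidean_group :: "('d::finite) isom monoid" where
  "euclidean_group =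
     \<lparr>carrier = UNIV \<times> {A. orthogonal_matrix A},
      mult = (\<lambda>(a, A) (b, B). (a + A *v b, A ** B)),
      one = (0, mat 1)\<rparr>"

abbreviation isom_group :: "('d::finite) isom set \<Rightarrow> 'd isom monoid" where
  "isom_group \<Gamma> \<equiv> euclidean_group\<lparr>carrier := \<Gamma>\<rparr>"

definition isom_apply :: "('d::finite) isom \<Rightarrow> real ^ 'd \<Rightarrow> real ^ 'd" where
  "isom_apply g x = fst g + snd g *v x"

definition isotropy :: "('d::finite) isom set \<Rightarrow> 'd isom set" where
  "isotropy \<Gamma> = stabilizer (isom_group \<Gamma>) isom_apply 0"

text \<open>The isotropy group of \<open>0\<close> consists of the elements \<open>(0, A)\<close> of \<open>\<Gamma>\<close>, so the projection
  $\pi(a, A) = A$ becomes the following map.\<close>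

definition isom_proj :: "('d::finite) isom \<Rightarrow> 'd isom" where
  "isom_proj g = (0, snd g)"

definition GL :: "(complex ^ 'm ^ 'm) monoid" where
  "GL = \<lparr>carrier = {A. invertible A}, mult = (**), one = mat 1\<rparr>"

section \<open>Function spaces\<close>

definition map_space ::
    "('d::finite isom \<Rightarrow> complex ^ 'm ^ 'm)
       \<Rightarrow> (real ^ 'd \<Rightarrow> complex ^ 'm, real ^ 'd, 'd isom) pattern_space" where
  "map_space \<psi> =
     \<lparr>carrier = UNIV,
      cut = (\<lambda>f C x. if x \<in> C then f x else 0),
      act = (\<lambda>g f x. \<psi> g *v f (isom_apply (inv\<^bsub>euclidean_group\<^esub> g) x))\<rparr>"

primrec Ck_differentiable ::
    "nat \<Rightarrow> ('a::euclidean_space \<Rightarrow> 'b::real_normed_vector) \<Rightarrow> bool" where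
  "Ck_differentiable 0 f \<longleftrightarrow> continuous_on UNIV f"
| "Ck_differentiable (Suc k) f \<longleftrightarrow>
     (\<forall>x. f differentiable (at x)) \<and>
     (\<forall>v. Ck_differentiable k (\<lambda>x. frechet_derivative f (at x) v))"

definition smooth :: "('a::euclidean_space \<Rightarrow> 'b::real_normed_vector) \<Rightarrow> bool" where
  "smooth f \<longleftrightarrow> (\<forall>k. Ck_differentiable k f)"

definition hermitian_inner :: "complex ^ 'm \<Rightarrow> complex ^ 'm \<Rightarrow> complex" where
  "hermitian_inner u v = (\<Sum>i\<in>UNIV. u $ i * cnj (v $ i))"

text \<open>The underlying set of the subshift $C^\infty_\psi(\mathbb{R}^d, \mathbb{C}^m, 0)$.\<close>

definition smooth_maps ::
    "('d::finite isom \<Rightarrow> complex ^ 'm ^ 'm) \<Rightarrow> (real ^ 'd \<Rightarrow> complex ^ 'm) set" where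
  "smooth_maps \<psi> = {f \<in> carrier (map_space \<psi>). \<forall>v. smooth (\<lambda>x. hermitian_inner (f x) v)}"

definition derivable_smooth_maps ::
    "('d::finite isom, 'b) monoid_scheme \<Rightarrow> ('d isom \<Rightarrow> complex ^ 'm ^ 'm)
       \<Rightarrow> ('p, 'x::metric_space, 'd isom) pattern_space \<Rightarrow> 'p
       \<Rightarrow> (real ^ 'd \<Rightarrow> complex ^ 'm) set" where
  "derivable_smooth_maps G \<psi> S P = {f \<in> smooth_maps \<psi>. locally_derivable G S P (map_space \<psi>) f}"

section \<open>The concrete spaces are abstract pattern spaces over \<open>isom_group \<Gamma>\<close>\<close>

lemma group_euclidean_group: "group euclidean_group"
proof (rule groupI)
  fix x :: "'a isom" assume x: "x \<in> carrier euclidean_group"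
  obtain a A where xa: "x = (a, A)" by (cases x)
  have o: "transpose A ** A = mat 1" "orthogonal_matrix (transpose A)"
    using x by (auto simp: xa euclidean_group_def orthogonal_matrix_def)
  show "\<exists>y\<in>carrier euclidean_group. y \<otimes>\<^bsub>euclidean_group\<^esub> x = \<one>\<^bsub>euclidean_group\<^esub>"
    using o by (intro bexI[of _ "(- (transpose A *v a), transpose A)"])
      (auto simp: euclidean_group_def xa)
qed (auto simp: euclidean_group_def orthogonal_matrix_mul orthogonal_matrix_id matrix_mul_assoc
      matrix_vector_mul_assoc matrix_vector_right_distrib)

lemma isom_apply_mult:
  "isom_apply (g \<otimes>\<^bsub>euclidean_group\<^esub> h) x = isom_apply g (isom_apply h x)"
  by (auto simp: isom_apply_def euclidean_group_def split: prod.splits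
      simp: matrix_vector_mul_assoc matrix_vector_right_distrib)

lemma isom_apply_one: "isom_apply \<one>\<^bsub>euclidean_group\<^esub> x = x"
  by (simp add: isom_apply_def euclidean_group_def)

lemma isotropy_iff: "g \<in> isotropy \<Gamma> \<longleftrightarrow> g \<in> \<Gamma> \<and> fst g = 0"
  by (auto simp: isotropy_def stabilizer_def isom_apply_def)

lemma group_actionI:
  assumes G: "group G"
    and c: "\<And>g x. g \<in> carrier G \<Longrightarrow> x \<in> E \<Longrightarrow> f g x \<in> E"
    and o: "\<And>x. x \<in> E \<Longrightarrow> f \<one>\<^bsub>G\<^esub> x = x"
    and m: "\<And>g h x. g \<in> carrier G \<Longrightarrow> h \<in> carrier G \<Longrightarrow> x \<in> E \<Longrightarrow> f (g \<otimes>\<^bsub>G\<^esub> h) x = f g (f h x)"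
  shows "group_action G E (\<lambda>g. restrict (f g) E)"
proof -
  interpret group G by fact
  have b: "restrict (f g) E \<in> Bij E" if g: "g \<in> carrier G" for g
  proof -
    have "bij_betw (f g) E E"
      by (rule bij_betw_byWitness[where f' = "f (inv\<^bsub>G\<^esub> g)"])
        (use g in \<open>auto simp: c o m[symmetric]\<close>)
    then show ?thesis by (auto simp: Bij_def cong: bij_betw_cong)
  qed
  show ?thesis
    unfolding group_action_def group_hom_def group_hom_axioms_def hom_def
    by (auto simp: G group_BijGroup) 
       (auto simp: BijGroup_def b compose_def c m intro!: ext)
qed

lemma group_isom_group: "subgroup \<Gamma> euclidean_group \<Longrightarrow> group (isom_group \<Gamma>)"
  by (simp add: group.subgroup_imp_group group_euclidean_group)

lemma action_isom:
  assumes "subgroup \<Gamma> euclidean_group"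
  shows "group_action (isom_group \<Gamma>) UNIV isom_apply"
  using group_actionI[OF group_isom_group[OF assms], of UNIV isom_apply]
  by (simp add: isom_apply_mult isom_apply_one restrict_def)

lemma supp_map:
 "closed C \<Longrightarrow> cut (map_space \<psi>) f C = f \<longleftrightarrow> closure {x. f x \<noteq> 0} \<subseteq> C"
proof -
  assume C: "closed C"
  have "cut (map_space \<psi>) f C = f \<longleftrightarrow> {x. f x \<noteq> 0} \<subseteq> C"
    by (auto simp: map_space_def fun_eq_iff)
  also have "\<dots> \<longleftrightarrow> closure {x. f x \<noteq> 0} \<subseteq> C"
    using C closure_minimal closure_subset by (meson order_trans)
  finally show ?thesis .
qed

lemma inv_apply:
  assumes "g \<in> carrier euclidean_group"
  shows "isom_apply (inv\<^bsub>euclidean_group\<^esub> g) (isom_apply g x) = x"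
    and "isom_apply g (isom_apply (inv\<^bsub>euclidean_group\<^esub> g) x) = x"
  using group.l_inv[OF group_euclidean_group assms] group.r_inv[OF group_euclidean_group assms]
  by (simp_all add: isom_apply_mult[symmetric] isom_apply_one)

lemma homeo_isom:
  assumes "g \<in> carrier euclidean_group"
  shows "homeomorphism UNIV UNIV (isom_apply g)
    (isom_apply (inv\<^bsub>euclidean_group\<^esub> g))"
proof -
  have c: "continuous_on UNIV (isom_apply h)" for h
    unfolding isom_apply_def by (intro continuous_intros matrix_vector_mult_linear_continuous_on)
  have "range (isom_apply g) = UNIV" "range (isom_apply (inv\<^bsub>euclidean_group\<^esub> g)) = UNIV"
    using inv_apply[OF assms] by (metis surjI)+
  then show ?thesis
    using inv_apply[OF assms] by (simp add: homeomorphism_def c)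
qed

lemma map_space_over:
  fixes \<Gamma> :: "('a::finite) isom set"
  assumes \<Gamma>: "subgroup \<Gamma> euclidean_group" and tr: "\<And>a. (a, mat 1) \<in> \<Gamma>"
   and phi: "\<phi> \<in> hom (isom_group (isotropy \<Gamma>)) GL"
  shows "abstract_pattern_space_over (isom_group \<Gamma>) isom_apply (map_space (\<phi> \<circ> isom_proj))"
proof -
  let ?E = "euclidean_group :: 'a isom monoid"
  interpret E: group ?E by (rule group_euclidean_group)
  interpret G: subgroup \<Gamma> ?E by fact
  have pr: "isom_proj g \<in> isotropy \<Gamma>" if "g \<in> \<Gamma>" for g
  proof -
    have "(- fst g, mat 1) \<otimes>\<^bsub>?E\<^esub> g \<in> \<Gamma>" using tr that by blast
    then show ?thesis by (auto simp: isotropy_iff isom_proj_def euclidean_group_def split: prod.splits)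
  qed
  have pm: "isom_proj (g \<otimes>\<^bsub>?E\<^esub> h) = isom_proj g \<otimes>\<^bsub>?E\<^esub> isom_proj h" for g h :: "'a isom"
    by (auto simp: isom_proj_def euclidean_group_def split: prod.splits)
  have m: "\<phi> (isom_proj (g \<otimes>\<^bsub>?E\<^esub> h)) = \<phi> (isom_proj g) ** \<phi> (isom_proj h)" 
    if "g \<in> \<Gamma>" "h \<in> \<Gamma>" for g h
    using phi pr[OF that(1)] pr[OF that(2)] by (auto simp: hom_def pm GL_def)
  have "isom_proj \<one>\<^bsub>?E\<^esub> = \<one>\<^bsub>?E\<^esub>" by (simp add: isom_proj_def euclidean_group_def)
  then have i: "\<one>\<^bsub>?E\<^esub> \<in> isotropy \<Gamma>" using pr[OF G.one_closed] by simp
  have inve: "invertible (\<phi> \<one>\<^bsub>?E\<^esub>)" 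
    and idem: "\<phi> \<one>\<^bsub>?E\<^esub> ** \<phi> \<one>\<^bsub>?E\<^esub> = \<phi> \<one>\<^bsub>?E\<^esub>"
    using phi i m[OF G.one_closed G.one_closed] \<open>isom_proj \<one>\<^bsub>?E\<^esub> = \<one>\<^bsub>?E\<^esub>\<close> by (auto simp: hom_def GL_def)
  obtain B where B: "B ** \<phi> \<one>\<^bsub>?E\<^esub> = mat 1"
    using inve by (auto simp: invertible_def)
  have "B ** (\<phi> \<one>\<^bsub>?E\<^esub> ** \<phi> \<one>\<^bsub>?E\<^esub>) = B ** \<phi> \<one>\<^bsub>?E\<^esub>"
    by (simp only: idem)
  then have o: "\<phi> \<one>\<^bsub>?E\<^esub> = mat 1"
    by (simp add: matrix_mul_assoc B)
  show ?thesis
  proof (intro abstract_pattern_space_over.intro abstract_pattern_space.intro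
      abstract_pattern_space_over_axioms.intro action_isom[OF \<Gamma>], goal_cases)
    case (4 f)
    show ?case by (intro exI[of _ "closure {x. f x \<noteq> 0}"]) (simp add: supp_map)
  next
    case (5 g)
    then have "g \<in> carrier ?E" by simp
    then show ?case by (blast intro: homeo_isom)
  next
    case 6
    show ?case
    proof (rule group_actionI[OF group_isom_group[OF \<Gamma>]], goal_cases)
      case (3 g h x)
      then have gh: "g \<in> \<Gamma>" "h \<in> \<Gamma>" by simp_all
      then have "inv\<^bsub>?E\<^esub> (g \<otimes>\<^bsub>?E\<^esub> h) = inv\<^bsub>?E\<^esub> h \<otimes>\<^bsub>?E\<^esub> inv\<^bsub>?E\<^esub> g"
        by (intro E.inv_mult_group) simp_all
      then show ?case
        by (simp add: map_space_def m[OF gh] isom_apply_mult matrix_vector_mul_assoc)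
    qed (auto simp: map_space_def o isom_apply_one \<open>isom_proj \<one>\<^bsub>?E\<^esub> = \<one>\<^bsub>?E\<^esub>\<close>)
  next
    case (7 g f C)
    then have g: "g \<in> carrier ?E" by (simp)
    have "x \<in> isom_apply g ` C \<longleftrightarrow> isom_apply (inv\<^bsub>?E\<^esub> g) x \<in> C" for x
      
    proof
      assume "x \<in> isom_apply g ` C"
      then show "isom_apply (inv\<^bsub>?E\<^esub> g) x \<in> C" by (auto simp: inv_apply(1)[OF g])
    next
      assume "isom_apply (inv\<^bsub>?E\<^esub> g) x \<in> C"
      then have "isom_apply g (isom_apply (inv\<^bsub>?E\<^esub> g) x) \<in> isom_apply g ` C" by (rule imageI)
      then show "x \<in> isom_apply g ` C" by (simp only: inv_apply(2)[OF g])
    qed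
    then show ?case by (auto simp: map_space_def fun_eq_iff)
  qed (auto simp: map_space_def)
qed

lemma isom_dist:
  assumes "g \<in> carrier euclidean_group"
  shows "dist (isom_apply g x) (isom_apply g y) = dist x y"
proof -
  have "orthogonal_transformation ((*v) (snd g))"
    using assms by (auto simp: euclidean_group_def orthogonal_transformation_matrix)
  then have "norm (snd g *v (x - y)) = norm (x - y)"
    by (rule orthogonal_transformation_norm)
  then show ?thesis
    by (simp add: isom_apply_def dist_norm matrix_vector_mult_diff_distrib)
qed

lemma UD_over:
  fixes \<Gamma> :: "('a::finite) isom set"
  assumes \<Gamma>: "subgroup \<Gamma> euclidean_group"
  shows "abstract_pattern_space_over (isom_group \<Gamma>) isom_apply (UD_space isom_apply)"
proof -
  let ?E = "euclidean_group :: 'a isom monoid"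
  interpret G: subgroup \<Gamma> ?E by fact
  show ?thesis
  proof (intro abstract_pattern_space_over.intro abstract_pattern_space.intro
      abstract_pattern_space_over_axioms.intro action_isom[OF \<Gamma>], goal_cases)
    case 1 have "uniformly_discrete {}" by (auto simp: uniformly_discrete_def intro: exI[of _ 1]) then show ?case by (auto simp: UD_space_def)
  next
    case (4 D)
    then obtain r where "r > 0" "\<forall>x\<in>D. \<forall>y\<in>D. x \<noteq> y \<longrightarrow> dist x y > r" by (auto simp: UD_space_def uniformly_discrete_def)
    then have "closed D" by (intro discrete_imp_closed[of r]) (auto, metis dist_commute not_less_iff_gr_or_eq)
    then show ?case by (intro exI[of _ D]) (auto simp: UD_space_def)
  next
    case (5 g)
    then have "g \<in> carrier ?E" by simp
    then show ?case by (blast intro: homeo_isom)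
  next
    case 6
    show ?case
    proof (rule group_actionI[OF group_isom_group[OF \<Gamma>]], goal_cases)
      case (1 g D)
      then show ?case by (fastforce simp: UD_space_def uniformly_discrete_def isom_dist)
    qed (auto simp: UD_space_def isom_apply_mult isom_apply_one image_comp comp_def)
  next
    case (7 g D C)
    then have g: "g \<in> carrier ?E" by (simp)
    have "inj (isom_apply g)"
      using inv_apply(1)[OF g] by (metis injI)
    then show ?case by (simp add: UD_space_def image_Int)
  qed (auto simp: UD_space_def uniformly_discrete_def)
qed

end

theory Submission
  imports Defs
begin

text \<open>
  The heart of the matter is that a glueable pattern \<open>P\<close> that is Delone-deriving and consists of
  bounded components is mutually locally derivable with a smooth function (\<open>ex_smooth_code\<close>). Given
  this, the theorem is formal. Local derivability is transitive, so mutually derivable patterns have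
  the same derivable functions. Conversely, suppose that \<open>P\<close> and \<open>P'\<close> have the same derivable
  functions, and let \<open>f\<close> be a smooth function mutually derivable with \<open>P\<close>. Then \<open>f\<close> is derivable
  from \<open>P'\<close>, and hence so is \<open>P\<close>; the other direction is symmetric.

  To construct \<open>f\<close>, take a Delone set \<open>D\<close> derivable from \<open>P\<close> and consider the patches
  \<open>cut S P (cball x r)\<close> for \<open>x \<in> D\<close>, with a large radius \<open>r\<close>. Since \<open>P\<close> consists of bounded components,
  it is the supremum of its patches (\<open>cut_is_supremum_of_patches\<close>), so it suffices that \<open>f\<close>
  encodes the patches. Call two points of \<open>D\<close> equivalent if an isometry in the group carries the patch
  of one to the patch of the other. There are countably many classes, and the symmetry
  group of each patch is finite, because a symmetry permutes the points of \<open>D\<close> inside the patch and is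
  determined by this permutation (\<open>finite_matching\<close>).

  For each class choose a representative \<open>p\<close> and, near \<open>p\<close>, a small affine frame in general position
  with respect to the symmetry group of the patch (\<open>ex_marker\<close>). Put a bump function on a ball
  around each point of the frame. All these balls, for all classes and all points of the
  frames, get different radii. Now copy these bumps by all isometries that carry the patch at \<open>p\<close>
  to the patch at some point of \<open>D\<close>, acting on the values through \<open>\<phi>\<close>, and let \<open>f\<close> be the sum. The
  balls are disjoint and locally finite, so \<open>f\<close> is smooth. By construction \<open>f\<close> is locally derivable from
  \<open>P\<close> (\<open>code_derivable\<close>). Conversely, an isometry that preserves \<open>f\<close> in a region
  permutes the components of the set where \<open>f\<close> is nonzero; the radius of a ball reveals its class
  and its place in the frame, and the frame reveals the isometry. So the isometry preserves the patches
  (\<open>pattern_derivable\<close>).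
\<close>

section \<open>Supports and the order of patterns\<close>

context abstract_pattern_space
begin

lemma supp_unique:
  assumes "P \<in> carrier S" "closed K" "\<And>C. closed C \<Longrightarrow> cut S P C = P \<longleftrightarrow> K \<subseteq> C"
  shows "supp S P = K"
  unfolding supp_def using assms
  by (intro the_equality) (auto intro!: antisym)

lemma
  assumes "P \<in> carrier S"
  shows closed_supp: "closed (supp S P)"
    and cut_eq_iff: "closed C \<Longrightarrow> cut S P C = P \<longleftrightarrow> supp S P \<subseteq> C"
proof -
  obtain K where K: "closed K" "\<forall>C. closed C \<longrightarrow> (cut S P C = P \<longleftrightarrow> K \<subseteq> C)"
    using ex_supp[OF assms] by blast
  then have "supp S P = K" using supp_unique[OF assms] by blast
  with K show "closed (supp S P)" "closed C \<Longrightarrow> cut S P C = P \<longleftrightarrow> supp S P \<subseteq> C" by auto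
qed

lemma cut_supp: "P \<in> carrier S \<Longrightarrow> cut S P (supp S P) = P"
  by (simp add: cut_eq_iff closed_supp)

lemma supp_cut_subset:
  assumes "P \<in> carrier S" "closed C"
  shows "supp S (cut S P C) \<subseteq> supp S P \<inter> C"
proof -
  have "cut S (cut S P C) (supp S P \<inter> C) = cut S (cut S P (supp S P)) C"
    using assms closed_supp[OF assms(1)] by (simp add: cut_cut closed_Int inf_commute inf_left_commute)
  then have "cut S (cut S P C) (supp S P \<inter> C) = cut S P C"
    using assms by (simp add: cut_supp)
  then show ?thesis
    using cut_eq_iff[OF cut_closed[OF assms], of "supp S P \<inter> C"] assms closed_supp by auto
qed

lemma pat_ge_cut:
  assumes "P \<in> carrier S" "closed C"
  shows "pat_ge S P (cut S P C)"
proof -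
  let ?K = "supp S (cut S P C)"
  have K: "closed ?K" "?K \<subseteq> C"
    using assms supp_cut_subset closed_supp cut_closed by auto
  have "cut S P ?K = cut S (cut S P C) ?K"
    using assms K by (simp add: cut_cut Int_absorb1)
  then show ?thesis
    using assms by (simp add: pat_ge_def cut_supp cut_closed)
qed

lemma pat_ge_cut_subset:
  assumes "P \<in> carrier S" "closed C" "closed D" "C \<subseteq> D"
  shows "pat_ge S (cut S P D) (cut S P C)"
  using pat_ge_cut[of "cut S P D" C] assms by (simp add: cut_closed cut_cut Int_absorb1)

lemma pat_ge_supp:
  assumes "P \<in> carrier S" "Q \<in> carrier S" "pat_ge S P Q"
  shows "supp S Q \<subseteq> supp S P"
  using supp_cut_subset[OF assms(1) closed_supp[OF assms(2)]] assms(3) by (simp add: pat_ge_def)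

lemma pat_ge_antisym:
  assumes "P \<in> carrier S" "Q \<in> carrier S" "pat_ge S P Q" "pat_ge S Q P"
  shows "P = Q"
  using assms pat_ge_supp[OF assms(1,2)] pat_ge_supp[OF assms(2,1)]
  by (metis cut_supp pat_ge_def subset_antisym)

lemma is_supremum_unique:
  "is_supremum S \<Xi> P \<Longrightarrow> is_supremum S \<Xi> Q \<Longrightarrow> P = Q"
  unfolding is_supremum_def by (blast intro: pat_ge_antisym)

end

section \<open>Glueing a pattern from its patches\<close>

text \<open>The supremum of the empty set is a least pattern. Its support is contained in the support of
  every \<open>cut S P {}\<close>, hence empty, so it coincides with every \<open>cut S P {}\<close>. This identifies the
  remains of patches that are too far away to meet a given ball.\<close>

lemma glueable_cut_empty:
  fixes S :: "('p, 'x::metric_space, 'g) pattern_space"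
  assumes "abstract_pattern_space S" "glueable S" "P \<in> carrier S" "Q \<in> carrier S"
  shows "cut S P {} = cut S Q {}"
proof -
  interpret abstract_pattern_space S by fact
  have "locally_finite_patterns S {} \<and> pairwise_compatible S {}"
    by (simp add: locally_finite_patterns_def pairwise_compatible_def)
  then obtain m where m: "is_supremum S {} m"
    using assms(2)[unfolded glueable_def, THEN spec, of "{}"] by auto
  have mc: "m \<in> carrier S" and le: "\<And>R. R \<in> carrier S \<Longrightarrow> pat_ge S R m"
    using m by (auto simp: is_supremum_def)
  have 0: "cut S R {} = m" if R: "R \<in> carrier S" for R
  proof -
    have "supp S m \<subseteq> supp S (cut S R {})"
      using le[OF cut_closed[OF R]] R mc by (intro pat_ge_supp) (auto intro: cut_closed)
    then have "supp S m = {}"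
      using supp_cut_subset[OF R, of "{}"] by auto
    then show ?thesis using le[OF R] by (simp add: pat_ge_def)
  qed
  show ?thesis
    using 0 assms(3,4) by simp
qed

lemma uniformly_discrete_finite:
  fixes D :: "'x::heine_borel set"
  assumes "uniformly_discrete D"
  shows "finite (D \<inter> cball x r)"
proof (rule ccontr)
  assume inf: "infinite (D \<inter> cball x r)"
  obtain s where s: "s > 0" "\<And>x y. x \<in> D \<Longrightarrow> y \<in> D \<Longrightarrow> x \<noteq> y \<Longrightarrow> dist x y > s"
    using assms by (auto simp: uniformly_discrete_def)
  obtain l where "l islimpt (D \<inter> cball x r)"
    using inf compact_cball[of x r] by (auto simp: compact_eq_Bolzano_Weierstrass)
  then have "infinite ((D \<inter> cball x r) \<inter> ball l (s/2))"
    using islimpt_eq_infinite_ball[of l "D \<inter> cball x r"] s(1) by auto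
  then obtain a where a: "a \<in> D \<inter> cball x r \<inter> ball l (s/2)" 
    by (metis all_not_in_conv infinite_imp_nonempty)
  have "infinite ((D \<inter> cball x r) \<inter> ball l (s/2) - {a})"
    using \<open>infinite ((D \<inter> cball x r) \<inter> ball l (s/2))\<close> by simp
  then obtain b where b: "b \<in> D \<inter> cball x r \<inter> ball l (s/2)" "b \<noteq> a" 
    by (metis Diff_iff all_not_in_conv infinite_imp_nonempty singletonI)
  have "dist a b < s"
    using a b dist_triangle_half_r[of l a s b] by auto
  with s(2)[of a b] a b show False by auto
qed

lemma disjoint_cballs_if_far:
  assumes "r + s < dist x y"
  shows "cball x r \<inter> cball y s = {}"
proof (rule equals0I)
  fix z assume "z \<in> cball x r \<inter> cball y s"
  then show False using assms dist_triangle[of x y z] by (auto simp: dist_commute)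
qed

text \<open>This is the condition of \<open>bounded_components\<close> for the closed set \<open>UNIV\<close>. In this form it
  visibly passes to the images of a pattern under isometries.\<close>

definition component_radius ::
    "('p, 'x::metric_space, 'g) pattern_space \<Rightarrow> 'p \<Rightarrow> real \<Rightarrow> bool" where
  "component_radius S P \<rho> \<longleftrightarrow> (\<forall>x\<in>supp S P. x \<in> supp S (cut S P (cball x \<rho>)))"


lemma bounded_components_radius:
  assumes "abstract_pattern_space S" "P \<in> carrier S" "bounded_components S P"
  obtains \<rho> where "\<rho> > 0" "component_radius S P \<rho>"
proof -
  interpret abstract_pattern_space S by fact
  have "cut S P UNIV = P" using assms by (simp add: cut_eq_iff)
  moreover obtain R where "R > 0" "\<forall>C. closed C \<longrightarrow>
        (\<forall>x\<in>supp S (cut S P C). x \<in> supp S (cut S (cut S P C) (cball x R)))"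
    using assms by (auto simp: bounded_components_def)
  ultimately have "component_radius S P R"
    unfolding component_radius_def by (metis closed_UNIV)
  then show ?thesis using that \<open>R > 0\<close> by blast
qed

definition patches ::
    "('p, 'x::metric_space, 'g) pattern_space \<Rightarrow> 'p \<Rightarrow> 'x set \<Rightarrow> real \<Rightarrow> 'x set \<Rightarrow> 'p set" where
  "patches S P D r C = (\<lambda>p. cut S (cut S P (cball p r)) C) ` D"

text \<open>The supremum of the patches lies below the pattern. As every component of the pattern is
  contained in a patch, the supremum has the same support, so it is the pattern.\<close>

lemma cut_is_supremum_of_patches:
  fixes S :: "('p, 'x::heine_borel, 'g) pattern_space"
  assumes "abstract_pattern_space S" and gl: "glueable S"
    and P: "P \<in> carrier S" "component_radius S P \<rho>"
    and D: "uniformly_discrete D" "\<And>x. \<exists>p\<in>D. dist x p < L"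
    and r: "\<rho> + L \<le> r" and C: "closed C"
  shows "is_supremum S (patches S P D r C) (cut S P C)"
proof -
  interpret abstract_pattern_space S by fact
  let ?\<Xi> = "(\<lambda>p. cut S P (cball p r)) ` D"
  have sub: "?\<Xi> \<subseteq> carrier S" using P by (auto intro: cut_closed)
  have "pairwise_compatible S ?\<Xi>"
    using P by (auto simp: pairwise_compatible_def compatible_def intro!: bexI[of _ P] pat_ge_cut)
  moreover have "locally_finite_patterns S ?\<Xi>"
    unfolding locally_finite_patterns_def
  proof (intro allI impI)
    fix x and s :: real
    have "(\<lambda>P. cut S P (cball x s)) ` ?\<Xi>
       \<subseteq> insert (cut S P {}) ((\<lambda>p. cut S (cut S P (cball p r)) (cball x s)) ` (D \<inter> cball x (r + s)))"
    proof (clarsimp simp: image_iff cut_cut P)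
      fix p assume p: "p \<in> D" and far: "\<forall>q\<in>D \<inter> cball x (r + s).
         cut S P (cball p r \<inter> cball x s) \<noteq> cut S P (cball q r \<inter> cball x s)"
      then have "dist x p > r + s" by (metis IntI linorder_not_le mem_cball)
      then have "cball p r \<inter> cball x s = {}"
        using disjoint_cballs_if_far[of s r x p] by (simp add: Int_commute add.commute)
      then show "cut S P (cball p r \<inter> cball x s) = cut S P {}" by simp
    qed
    then show "finite ((\<lambda>P. cut S P (cball x s)) ` ?\<Xi>)"
      using uniformly_discrete_finite[OF D(1)] by (meson finite.insertI finite_imageI finite_subset)
  qed
  ultimately obtain P' where P': "is_supremum S ?\<Xi> P'"
    and cP': "is_supremum S ((\<lambda>Q. cut S Q C) ` ?\<Xi>) (cut S P' C)"
    using gl[unfolded glueable_def, THEN spec, of ?\<Xi>] sub C by auto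
  have P'c: "P' \<in> carrier S" and ub: "\<And>p. p \<in> D \<Longrightarrow> pat_ge S P' (cut S P (cball p r))"
    and le: "pat_ge S P P'"
    using P' P pat_ge_cut by (auto simp: is_supremum_def)
  have "supp S P \<subseteq> supp S P'"
  proof
    fix x assume "x \<in> supp S P"
    then have x: "x \<in> supp S (cut S P (cball x \<rho>))" using P by (simp add: component_radius_def)
    obtain p where p: "p \<in> D" "dist x p < L" using D(2) by blast
    have "cball x \<rho> \<subseteq> cball p r"
    proof
      fix z assume "z \<in> cball x \<rho>"
      then show "z \<in> cball p r"
        using p r dist_triangle[of p z x] by (auto simp: dist_commute)
    qed
    then have "pat_ge S (cut S P (cball p r)) (cut S P (cball x \<rho>))"
      using P by (intro pat_ge_cut_subset) auto
    then have "x \<in> supp S (cut S P (cball p r))"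
      using x pat_ge_supp[OF cut_closed[OF P(1) closed_cball] cut_closed[OF P(1) closed_cball]] by blast
    then show "x \<in> supp S P'"
      using pat_ge_supp[OF P'c cut_closed[OF P(1) closed_cball] ub[OF p(1)]] by blast
  qed
  then have "P' = P"
    using le cut_eq_iff[OF P(1) closed_supp[OF P'c]] by (simp add: pat_ge_def)
  with cP' show ?thesis by (simp add: patches_def image_image)
qed

text \<open>A patch with centre further away than \<open>R + r\<close> misses the ball of radius \<open>R\<close> and is cut down to the
  least pattern. So both restrictions to the ball are suprema of the same set.\<close>

lemma patterns_agree_if_patches_agree:
  fixes S :: "('p, 'x::heine_borel, 'g) pattern_space"
  assumes S: "abstract_pattern_space S" and gl: "glueable S"
    and P: "P \<in> carrier S" "component_radius S P \<rho>"
    and Q: "Q \<in> carrier S" "component_radius S Q \<rho>"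
    and D: "uniformly_discrete D" "\<And>x. \<exists>p\<in>D. dist x p < L"
    and r: "\<rho> + L \<le> r"
    and agree: "\<And>p. p \<in> D \<Longrightarrow> dist y p \<le> R + r \<Longrightarrow> cut S P (cball p r) = cut S Q (cball p r)"
  shows "cut S P (cball y R) = cut S Q (cball y R)"
proof -
  interpret abstract_pattern_space S by fact
  have "cut S (cut S P (cball p r)) (cball y R) = cut S (cut S Q (cball p r)) (cball y R)"
    if p: "p \<in> D" for p
  proof (cases "dist y p \<le> R + r")
    case False
    then have "cball p r \<inter> cball y R = {}"
      using disjoint_cballs_if_far[of R r y p] by (simp add: Int_commute)
    then show ?thesis using P Q glueable_cut_empty[OF S gl P(1) Q(1)] by (simp add: cut_cut)
  qed (simp add: agree p)
  then have "patches S P D r (cball y R) = patches S Q D r (cball y R)"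
    by (simp add: patches_def)
  then show ?thesis
    using cut_is_supremum_of_patches[OF S gl P D r closed_cball]
      cut_is_supremum_of_patches[OF S gl Q D r closed_cball] is_supremum_unique by metis
qed

section \<open>Local derivability under a group of isometries\<close>

abbreviation isom_comp :: "('d::finite) isom \<Rightarrow> 'd isom \<Rightarrow> 'd isom" (infixl "\<odot>" 70) where
  "g \<odot> h \<equiv> g \<otimes>\<^bsub>euclidean_group\<^esub> h"

abbreviation isom_inv :: "('d::finite) isom \<Rightarrow> 'd isom" where
  "isom_inv g \<equiv> inv\<^bsub>euclidean_group\<^esub> g"

abbreviation isom_one :: "('d::finite) isom" where
  "isom_one \<equiv> \<one>\<^bsub>euclidean_group\<^esub>"

locale isometry_group =
  fixes \<Gamma> :: "('d::finite) isom set"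
  assumes subgroup: "subgroup \<Gamma> euclidean_group"
    and translation: "(a, mat 1) \<in> \<Gamma>"
begin

lemma carrier: "g \<in> \<Gamma> \<Longrightarrow> g \<in> carrier euclidean_group"
  using subgroup by (rule subgroup.mem_carrier)

lemma comp_closed: "g \<in> \<Gamma> \<Longrightarrow> h \<in> \<Gamma> \<Longrightarrow> g \<odot> h \<in> \<Gamma>"
  using subgroup by (rule subgroup.m_closed)

lemma inv_closed: "g \<in> \<Gamma> \<Longrightarrow> isom_inv g \<in> \<Gamma>"
  using subgroup by (rule subgroup.m_inv_closed)

lemma one_closed: "isom_one \<in> \<Gamma>"
  using subgroup by (rule subgroup.one_closed)

lemma inv_comp: "g \<in> \<Gamma> \<Longrightarrow> isom_inv g \<odot> g = isom_one" "g \<in> \<Gamma> \<Longrightarrow> g \<odot> isom_inv g = isom_one"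
  using carrier group.l_inv[OF group_euclidean_group] group.r_inv[OF group_euclidean_group] by blast+

lemma comp_assoc: "g \<in> \<Gamma> \<Longrightarrow> h \<in> \<Gamma> \<Longrightarrow> k \<in> \<Gamma> \<Longrightarrow> g \<odot> h \<odot> k = g \<odot> (h \<odot> k)"
  using carrier monoid.m_assoc[OF group.is_monoid[OF group_euclidean_group]] by blast

lemma comp_inv_cancel:
  assumes "g \<in> \<Gamma>" "h \<in> \<Gamma>"
  shows "isom_inv g \<odot> (g \<odot> h) = h" "g \<odot> (isom_inv g \<odot> h) = h"
  using assms inv_closed carrier
  by (simp_all add: comp_assoc[symmetric] inv_comp monoid.l_one[OF group.is_monoid[OF group_euclidean_group]])

lemma dist_isom: "g \<in> \<Gamma> \<Longrightarrow> dist (isom_apply g x) (isom_apply g y) = dist x y"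
  by (simp add: carrier isom_dist)

lemma apply_inv:
  "g \<in> \<Gamma> \<Longrightarrow> isom_apply (isom_inv g) (isom_apply g x) = x"
  "g \<in> \<Gamma> \<Longrightarrow> isom_apply g (isom_apply (isom_inv g) x) = x"
  by (simp_all add: carrier inv_apply)

lemma dist_isom_inv:
  "g \<in> \<Gamma> \<Longrightarrow> dist (isom_apply (isom_inv g) x) y = dist x (isom_apply g y)"
  "g \<in> \<Gamma> \<Longrightarrow> dist y (isom_apply (isom_inv g) x) = dist (isom_apply g y) x"
  using dist_isom[of g "isom_apply (isom_inv g) x" y] dist_isom[of g y "isom_apply (isom_inv g) x"]
  by (simp_all add: apply_inv)

lemma isom_image_eq: "g \<in> \<Gamma> \<Longrightarrow> z \<in> isom_apply g ` A \<longleftrightarrow> isom_apply (isom_inv g) z \<in> A"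
  by (auto simp: apply_inv intro: image_eqI[of _ _ "isom_apply (isom_inv g) z"])

lemma isom_image_cball: "g \<in> \<Gamma> \<Longrightarrow> isom_apply g ` cball x r = cball (isom_apply g x) r"
  by (simp add: set_eq_iff isom_image_eq dist_isom_inv)

lemma isom_image_ball: "g \<in> \<Gamma> \<Longrightarrow> isom_apply g ` ball x r = ball (isom_apply g x) r"
  by (simp add: set_eq_iff isom_image_eq dist_isom_inv)

lemma connected_isom_image: "connected A \<Longrightarrow> connected (isom_apply g ` A)"
  unfolding isom_apply_def
  by (intro connected_continuous_image continuous_intros matrix_vector_mult_linear_continuous_on)

end

locale isometric_patterns = isometry_group \<Gamma>
  for \<Gamma> :: "('d::finite) isom set" +
  fixes S :: "('p, real ^ 'd, 'd isom) pattern_space"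
  assumes over: "abstract_pattern_space_over (isom_group \<Gamma>) isom_apply S"
begin

sublocale abstract_pattern_space S
  using over by (rule abstract_pattern_space_over.axioms)

lemma action_S: "group_action (isom_group \<Gamma>) (carrier S) (\<lambda>g. restrict (act S g) (carrier S))"
  using abstract_pattern_space_over.action[OF over] .

lemma act_closed: "g \<in> \<Gamma> \<Longrightarrow> Q \<in> carrier S \<Longrightarrow> act S g Q \<in> carrier S"
  using group_action.element_image[OF action_S, of g Q] by simp

lemma act_comp: "g \<in> \<Gamma> \<Longrightarrow> h \<in> \<Gamma> \<Longrightarrow> Q \<in> carrier S \<Longrightarrow> act S (g \<odot> h) Q = act S g (act S h Q)"
  using group_action.composition_rule[OF action_S, of Q g h] by (simp add: act_closed)

lemma act_one: "Q \<in> carrier S \<Longrightarrow> act S isom_one Q = Q"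
  using fun_cong[OF group_action.id_eq_one[OF action_S], of Q] by simp

lemma act_inv: 
  assumes "g \<in> \<Gamma>" "Q \<in> carrier S"
  shows "act S (isom_inv g) (act S g Q) = Q" "act S g (act S (isom_inv g) Q) = Q"
  using assms by (simp_all add: act_comp[symmetric] inv_closed inv_comp act_one)

lemma cut_act:
  "g \<in> \<Gamma> \<Longrightarrow> Q \<in> carrier S \<Longrightarrow> closed C \<Longrightarrow> cut S (act S g Q) (isom_apply g ` C) = act S g (cut S Q C)"
  using abstract_pattern_space_over.act_cut[OF over] by simp

definition agree_on :: "'p \<Rightarrow> 'p \<Rightarrow> real ^ 'd \<Rightarrow> real \<Rightarrow> bool" where
  "agree_on P Q x r \<longleftrightarrow> cut S P (cball x r) = cut S Q (cball x r)"

lemma agree_on_sym: "agree_on P Q x r \<longleftrightarrow> agree_on Q P x r"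
  by (auto simp: agree_on_def)

lemma agree_on_refl: "agree_on P P x r"
  by (auto simp: agree_on_def)

lemma agree_on_smaller:
  assumes "agree_on P Q x r" "P \<in> carrier S" "Q \<in> carrier S" "dist x y + s \<le> r"
  shows "agree_on P Q y s"
proof -
  have "cball y s \<subseteq> cball x r"
  proof
    fix z assume "z \<in> cball y s"
    then show "z \<in> cball x r" using assms(4) dist_triangle[of x z y] by auto
  qed
  then have "cut S R (cball y s) = cut S (cut S R (cball x r)) (cball y s)" if "R \<in> carrier S" for R
    using that by (simp add: cut_cut Int_absorb1)
  then show ?thesis
    using assms by (simp add: agree_on_def)
qed

lemma agree_on_act:
  assumes "g \<in> \<Gamma>" "P \<in> carrier S" "Q \<in> carrier S"
  shows "agree_on (act S g P) (act S g Q) (isom_apply g x) r \<longleftrightarrow> agree_on P Q x r"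
proof
  show "agree_on (act S g P) (act S g Q) (isom_apply g x) r" if "agree_on P Q x r"
    using that assms by (simp add: agree_on_def isom_image_cball[symmetric] cut_act)
next
  assume "agree_on (act S g P) (act S g Q) (isom_apply g x) r"
  then have "act S g (cut S P (cball x r)) = act S g (cut S Q (cball x r))"
    using assms by (simp add: agree_on_def isom_image_cball[symmetric] cut_act)
  then have "act S (isom_inv g) (act S g (cut S P (cball x r))) =
      act S (isom_inv g) (act S g (cut S Q (cball x r)))" by simp
  then show "agree_on P Q x r"
    using assms by (simp add: agree_on_def act_inv cut_closed)
qed

lemma supp_act:
  assumes "g \<in> \<Gamma>" "Q \<in> carrier S"
  shows "supp S (act S g Q) = isom_apply g ` supp S Q"
proof (rule supp_unique)
  have cl: "closed (isom_apply g ` C) " if "closed C" "g \<in> \<Gamma>" for C g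
    using homeomorphism_imp_closed_map[OF homeo_isom[OF carrier[OF that(2)]], of C] that by simp
  show "closed (isom_apply g ` supp S Q)"
    using cl closed_supp assms by simp
  fix C :: "(real^'d) set" assume C: "closed C"
  let ?C = "isom_apply (isom_inv g) ` C"
  have C': "closed ?C" "isom_apply g ` ?C = C"
    using cl C assms by (auto simp: inv_closed image_image apply_inv)
  have "cut S (act S g Q) C = act S g Q \<longleftrightarrow> act S g (cut S Q ?C) = act S g Q"
    using cut_act[OF assms C'(1)] C'(2) by simp
  also have "\<dots> \<longleftrightarrow> cut S Q ?C = Q"
    using assms C' act_inv(1)[OF assms(1) cut_closed[OF assms(2) C'(1)]] act_inv(1)[OF assms] by auto
  also have "\<dots> \<longleftrightarrow> supp S Q \<subseteq> ?C"
    using assms C' by (simp add: cut_eq_iff)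
  also have "\<dots> \<longleftrightarrow> isom_apply g ` supp S Q \<subseteq> C"
  proof -
    have "z \<in> ?C \<longleftrightarrow> isom_apply g z \<in> C" for z
      using assms by (auto simp: apply_inv intro: image_eqI[of _ _ "isom_apply g z"])
    then show ?thesis unfolding image_subset_iff subset_eq[of "supp S Q"] by simp
  qed
  finally show "cut S (act S g Q) C = act S g Q \<longleftrightarrow> isom_apply g ` supp S Q \<subseteq> C" .
qed (simp add: act_closed assms)

lemma component_radius_act:
  assumes "g \<in> \<Gamma>" "Q \<in> carrier S" "component_radius S Q \<rho>"
  shows "component_radius S (act S g Q) \<rho>"
  using assms 
  by (auto simp: component_radius_def supp_act isom_image_cball[symmetric] cut_act cut_closed)

end

text \<open>Derivability compares two arbitrary elements of the group at two fixed base points. As the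
  group contains the translations, one may instead compare a single element with the identity
  at an arbitrary point, and the base points disappear.\<close>

definition pointwise_derivable ::
    "('d::finite) isom set \<Rightarrow> ('p, real ^ 'd, 'd isom) pattern_space \<Rightarrow> 'p
       \<Rightarrow> ('q, real ^ 'd, 'd isom) pattern_space \<Rightarrow> 'q \<Rightarrow> real \<Rightarrow> bool" where
  "pointwise_derivable \<Gamma> S P T Q R0 \<longleftrightarrow>
     (\<forall>g\<in>\<Gamma>. \<forall>y. \<forall>R\<ge>0.
        cut S (act S g P) (cball y (R + R0)) = cut S P (cball y (R + R0)) \<longrightarrow>
        cut T (act T g Q) (cball y R) = cut T Q (cball y R))"

lemma locally_derivable_iff_pointwise:
  assumes "isometric_patterns \<Gamma> S" "isometric_patterns \<Gamma> T" "P \<in> carrier S" "Q \<in> carrier T"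
  shows "locally_derivable (isom_group \<Gamma>) S P T Q \<longleftrightarrow>
    (\<exists>R0\<ge>0. pointwise_derivable \<Gamma> S P T Q R0)"
proof -
  interpret S: isometric_patterns \<Gamma> S by fact
  interpret T: isometric_patterns \<Gamma> T by fact
  have carrier_eq: "carrier (isom_group \<Gamma>) = \<Gamma>" by simp
  note cl = S.act_closed T.act_closed assms(3,4) S.comp_closed S.inv_closed
  show ?thesis
  proof
    assume "locally_derivable (isom_group \<Gamma>) S P T Q"
    then obtain x0 y0 R0 where R0: "R0 \<ge> 0" and
      "\<forall>g\<in>\<Gamma>. \<forall>h\<in>\<Gamma>. \<forall>R\<ge>0. S.agree_on (act S g P) (act S h P) x0 (R + R0) \<longrightarrow>
         T.agree_on (act T g Q) (act T h Q) y0 R"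
      unfolding locally_derivable_def carrier_eq S.agree_on_def T.agree_on_def by blast
    note ld = this(2)[rule_format]
    let ?\<delta> = "dist x0 y0"
    have "pointwise_derivable \<Gamma> S P T Q (R0 + ?\<delta>)"
      unfolding pointwise_derivable_def S.agree_on_def[symmetric] T.agree_on_def[symmetric]
    proof (intro ballI allI impI)
      fix g y and R :: real
      assume g: "g \<in> \<Gamma>" and R: "0 \<le> R" 
        and ag: "S.agree_on (act S g P) P y (R + (R0 + ?\<delta>))"
      \<comment> \<open>This translation moves \<open>y\<close> to the base point of \<open>P\<close>. The other base point is at distance
        \<open>?\<delta>\<close>, which is paid for by the larger radius.\<close>
      let ?t = "(x0 - y, mat 1) :: 'a isom"
      have t: "?t \<in> \<Gamma>" by (rule S.translation)
      have ty: "isom_apply ?t y = x0" by (simp add: isom_apply_def)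
      have "S.agree_on (act S (?t \<odot> g) P) (act S ?t P) x0 (R + ?\<delta> + R0)"
        using ag S.agree_on_act[OF t, of "act S g P" P y] ty g t by (simp add: cl S.act_comp ac_simps)
      then have "T.agree_on (act T (?t \<odot> g) Q) (act T ?t Q) y0 (R + ?\<delta>)"
        using ld[of "?t \<odot> g" ?t "R + ?\<delta>"] g t R by (simp add: cl)
      then have "T.agree_on (act T (?t \<odot> g) Q) (act T ?t Q) x0 R"
        by (rule T.agree_on_smaller) (use g t in \<open>auto simp: cl dist_commute\<close>)
      then show "T.agree_on (act T g Q) Q y R"
        using T.agree_on_act[OF t, of "act T g Q" Q y] ty g t by (simp add: cl T.act_comp)
    qed
    with R0 show "\<exists>R0\<ge>0. pointwise_derivable \<Gamma> S P T Q R0"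
      by (intro exI[of _ "R0 + ?\<delta>"]) auto
  next
    assume "\<exists>R0\<ge>0. pointwise_derivable \<Gamma> S P T Q R0"
    then obtain R0 where R0: "R0 \<ge> 0" and
      ld: "\<And>g y R. g \<in> \<Gamma> \<Longrightarrow> R \<ge> 0 \<Longrightarrow>
         S.agree_on (act S g P) P y (R + R0) \<Longrightarrow> T.agree_on (act T g Q) Q y R"
      unfolding pointwise_derivable_def S.agree_on_def T.agree_on_def by blast
    have "T.agree_on (act T g Q) (act T h Q) 0 R"
      if g: "g \<in> \<Gamma>" and h: "h \<in> \<Gamma>" and R: "R \<ge> 0"
        and ag: "S.agree_on (act S g P) (act S h P) 0 (R + R0)" for g h R
    proof -
      let ?k = "isom_inv h \<odot> g" and ?y = "isom_apply (isom_inv h) 0"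
      have k: "?k \<in> \<Gamma>" "h \<odot> ?k = g" using g h by (simp_all add: cl S.comp_inv_cancel)
      have hy: "isom_apply h ?y = 0" using h by (simp add: S.apply_inv)
      have "S.agree_on (act S ?k P) P ?y (R + R0)"
        using ag S.agree_on_act[OF h, of "act S ?k P" P ?y] k h hy
        by (simp add: cl S.act_comp[symmetric])
      then have "T.agree_on (act T ?k Q) Q ?y R"
        using ld k R by blast
      then show ?thesis
        using T.agree_on_act[OF h, of "act T ?k Q" Q ?y] k h hy
        by (simp add: cl T.act_comp[symmetric])
    qed
    then show "locally_derivable (isom_group \<Gamma>) S P T Q"
      using R0 unfolding locally_derivable_def carrier_eq S.agree_on_def T.agree_on_def by blast
  qed
qed

lemma locally_derivable_trans:
  assumes "isometric_patterns \<Gamma> S" "isometric_patterns \<Gamma> T" "isometric_patterns \<Gamma> U"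
    and "P \<in> carrier S" "Q \<in> carrier T" "R \<in> carrier U"
    and "locally_derivable (isom_group \<Gamma>) S P T Q" "locally_derivable (isom_group \<Gamma>) T Q U R"
  shows "locally_derivable (isom_group \<Gamma>) S P U R"
proof -
  obtain r1 r2 where r: "r1 \<ge> 0" "pointwise_derivable \<Gamma> S P T Q r1"
     "r2 \<ge> 0" "pointwise_derivable \<Gamma> T Q U R r2"
    using assms by (auto simp: locally_derivable_iff_pointwise)
  have "pointwise_derivable \<Gamma> S P U R (r2 + r1)"
    unfolding pointwise_derivable_def
  proof (intro ballI allI impI)
    fix g y and t :: real
    assume "g \<in> \<Gamma>" "0 \<le> t" "cut S (act S g P) (cball y (t + (r2 + r1))) = cut S P (cball y (t + (r2 + r1)))"
    then have "cut T (act T g Q) (cball y (t + r2)) = cut T Q (cball y (t + r2))"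
      using r(2,3) unfolding pointwise_derivable_def add.assoc[symmetric] by simp
    then show "cut U (act U g R) (cball y t) = cut U R (cball y t)"
      using \<open>g \<in> \<Gamma>\<close> \<open>0 \<le> t\<close> r(4) unfolding pointwise_derivable_def by blast
  qed
  then show ?thesis
    unfolding locally_derivable_iff_pointwise[OF assms(1,3,4,6)]
    using r(1,3) by (intro exI[of _ "r2 + r1"]) simp
qed

section \<open>Smooth bump functions\<close>

lemma Ck_differentiable_frechet:
  assumes "\<And>x. (f has_derivative f' x) (at x)"
  shows "Ck_differentiable (Suc k) f \<longleftrightarrow> (\<forall>v. Ck_differentiable k (\<lambda>x. f' x v))"
proof -
  have "frechet_derivative f (at x) = f' x" for x
    using assms frechet_derivative_at by metis
  then show ?thesis using assms by (auto simp: differentiable_def)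
qed

lemma Ck_differentiable_has_derivative:
  "Ck_differentiable (Suc k) f \<Longrightarrow> (f has_derivative frechet_derivative f (at x)) (at x)"
  by (simp add: frechet_derivative_works)

lemma Ck_differentiable_pred: "Ck_differentiable (Suc k) f \<Longrightarrow> Ck_differentiable k f"
proof (induction k arbitrary: f)
  case 0
  then have "\<forall>x. f differentiable (at x)" by simp
  then have "\<forall>x. isCont f x" by (blast intro: differentiable_imp_continuous_within)
  then show ?case by (simp add: continuous_at_imp_continuous_on)
next
  case (Suc k)
  then show ?case by (metis Ck_differentiable.simps(2))
qed

lemma Ck_differentiable_const: "Ck_differentiable k (\<lambda>x. c)"
proof (induction k arbitrary: c)
  case (Suc k)
  show ?case by (subst Ck_differentiable_frechet[OF has_derivative_const]) (simp add: Suc)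
qed simp

lemma Ck_differentiable_bounded_linear:
  assumes L: "bounded_linear L" and "Ck_differentiable k f"
  shows "Ck_differentiable k (\<lambda>x. L (f x))"
  using assms(2)
proof (induction k arbitrary: f)
  case 0
  then show ?case
    using L by (auto intro: bounded_linear.continuous_on)
next
  case (Suc k)
  show ?case
    by (subst Ck_differentiable_frechet[OF bounded_linear.has_derivative[OF L
            Ck_differentiable_has_derivative[OF Suc.prems]]])
      (use Suc in auto)
qed

lemma Ck_differentiable_add:
  assumes "Ck_differentiable k f" "Ck_differentiable k g"
  shows "Ck_differentiable k (\<lambda>x. f x + g x)"
  using assms
proof (induction k arbitrary: f g)
  case 0
  then show ?case by (auto intro: continuous_intros)
next
  case (Suc k)
  show ?case
    by (subst Ck_differentiable_frechet[OF has_derivative_add[OF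
            Ck_differentiable_has_derivative[OF Suc.prems(1)]
            Ck_differentiable_has_derivative[OF Suc.prems(2)]]])
      (use Suc in auto)
qed

lemma Ck_differentiable_sum:
  "(\<And>i. i \<in> I \<Longrightarrow> Ck_differentiable k (f i)) \<Longrightarrow> Ck_differentiable k (\<lambda>x. \<Sum>i\<in>I. f i x)"
  by (induction I rule: infinite_finite_induct)
    (auto intro: Ck_differentiable_const Ck_differentiable_add)

lemma Ck_differentiable_mult:
  fixes f g :: "'a::euclidean_space \<Rightarrow> real"
  assumes "Ck_differentiable k f" "Ck_differentiable k g"
  shows "Ck_differentiable k (\<lambda>x. f x * g x)"
  using assms
proof (induction k arbitrary: f g)
  case 0
  then show ?case by (auto intro: continuous_intros)
next
  case (Suc k)
  show ?case
    by (subst Ck_differentiable_frechet[OF has_derivative_mult[OF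
            Ck_differentiable_has_derivative[OF Suc.prems(1)]
            Ck_differentiable_has_derivative[OF Suc.prems(2)]]])
      (use Suc Ck_differentiable_pred in \<open>auto intro!: Ck_differentiable_add Suc.IH\<close>)
qed

text \<open>Differentiability of any order may be checked on neighbourhoods, because the derivative of \<open>f\<close>
  agrees with the derivative of \<open>h\<close> on the open set where \<open>f\<close> and \<open>h\<close> agree.\<close>

lemma Ck_differentiable_local:
  assumes "\<And>x. \<exists>U h. open U \<and> x \<in> U \<and> Ck_differentiable k h \<and> (\<forall>z\<in>U. f z = h z)"
  shows "Ck_differentiable k f"
  using assms
proof (induction k arbitrary: f)
  case 0
  have "isCont f x" for x
  proof -
    obtain U h where U: "open U" "x \<in> U" "continuous_on UNIV h" "\<forall>z\<in>U. f z = h z"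
      using 0[of x] by auto
    then have "eventually (\<lambda>z. f z = h z) (nhds x)"
      by (auto simp: eventually_nhds)
    then show ?thesis
      using isCont_cong U(3) by (metis UNIV_I continuous_on_eq_continuous_at open_UNIV)
  qed
  then show ?case by (simp add: continuous_at_imp_continuous_on)
next
  case (Suc k)
  have *: "(f has_derivative frechet_derivative h (at z)) (at z)"
    if "open U" "z \<in> U" "Ck_differentiable (Suc k) h" "\<forall>z\<in>U. f z = h z" for U h z
    by (rule has_derivative_transform_within_open[OF Ck_differentiable_has_derivative[OF that(3)] that(1,2)])
       (use that in auto)
  have d: "f differentiable (at x)" for x
    using * Suc.prems[of x] by (meson differentiableI)
  have "Ck_differentiable k (\<lambda>x. frechet_derivative f (at x) v)" for v
  proof (rule Suc.IH)
    fix x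
    obtain U h where U: "open U" "x \<in> U" "Ck_differentiable (Suc k) h" "\<forall>z\<in>U. f z = h z"
      using Suc.prems by blast
    have "\<forall>z\<in>U. frechet_derivative f (at z) v = frechet_derivative h (at z) v"
      using *[OF U(1) _ U(3,4)] frechet_derivative_at by metis
    then show "\<exists>U h. open U \<and> x \<in> U \<and> Ck_differentiable k h
        \<and> (\<forall>z\<in>U. frechet_derivative f (at z) v = h z)"
      using U by (intro exI[of _ U] exI[of _ "\<lambda>z. frechet_derivative h (at z) v"]) auto
  qed
  with d show ?case by simp
qed

text \<open>The exponent \<open>n\<close> makes the family closed under differentiation up to linear combinations
  (\<open>flat_exp_deriv\<close>), so that smoothness follows by induction on the order, for all \<open>n\<close> at once.\<close>

definition flat_exp :: "nat \<Rightarrow> real \<Rightarrow> real" where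
  "flat_exp n t = (if t > 0 then exp (- (1 / t)) / t ^ n else 0)"

text \<open>With \<open>x = 1 / t\<close> this is one term of the exponential series, \<open>x ^ (n + 2) / fact (n + 2) \<le> exp x\<close>.
  The quadratic bound makes the derivative at \<open>0\<close> vanish.\<close>

lemma flat_exp_le:
  assumes "t > 0"
  shows "flat_exp n t \<le> fact (n + 2) * t\<^sup>2"
proof -
  let ?x = "1 / t"
  have aux: "a \<le> b * c" if "a /\<^sub>R b \<le> c" "b > 0" for a b c :: real
    using that by (simp add: field_simps)
  have "?x ^ (n + 2) /\<^sub>R fact (n + 2) = (\<Sum>k\<in>{n + 2}. ?x ^ k /\<^sub>R fact k)" by simp
  also have "\<dots> \<le> (\<Sum>k. ?x ^ k /\<^sub>R fact k)"
    using assms summable_exp_generic[of ?x] by (intro sum_le_suminf) auto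
  finally have "?x ^ (n + 2) /\<^sub>R fact (n + 2) \<le> exp ?x" by (simp only: exp_def)
  then have "?x ^ (n + 2) \<le> fact (n + 2) * exp ?x"
    by (rule aux) (rule fact_gt_zero)
  then have "?x ^ (n + 2) * (exp (- ?x) * t\<^sup>2) \<le> fact (n + 2) * exp ?x * (exp (- ?x) * t\<^sup>2)"
    by (intro mult_right_mono) (simp_all del: fact_Suc)
  moreover have "?x ^ (n + 2) * (exp (- ?x) * t\<^sup>2) = flat_exp n t"
    using assms by (simp add: flat_exp_def power_add power_one_over power2_eq_square)
  moreover have "exp ?x * (exp (- ?x) * t\<^sup>2) = t\<^sup>2"
    by (simp add: mult.assoc[symmetric] exp_minus_inverse)
  ultimately show ?thesis by (simp only: mult.assoc)
qed

lemma flat_exp_deriv: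
  "(flat_exp n has_real_derivative flat_exp (n + 2) t - n * flat_exp (n + 1) t) (at t)"
proof (cases t "0::real" rule: linorder_cases)
  case less
  have "((\<lambda>_. 0) has_real_derivative 0) (at t)" by simp
  then have "(flat_exp n has_real_derivative 0) (at t)"
    by (rule has_field_derivative_transform_within[where d = "- t"]) (use less in \<open>auto simp: flat_exp_def dist_real_def\<close>)
  then show ?thesis using less by (simp add: flat_exp_def)
next
  case equal
  have "((\<lambda>h. flat_exp n h / h) \<longlongrightarrow> 0) (at 0)"
  proof (rule Lim_null_comparison)
    have "norm (flat_exp n h / h) \<le> fact (n + 2) * \<bar>h\<bar>" for h
    proof (cases "h > 0")
      case True
      then have "flat_exp n h / h \<le> fact (n + 2) * h"
        using flat_exp_le[OF True, of n] by (simp add: pos_divide_le_eq power2_eq_square mult.assoc)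
      then show ?thesis using True by (simp add: flat_exp_def)
    next
      case False
      then have "flat_exp n h = 0" by (simp add: flat_exp_def)
      then show ?thesis by (simp only: div_0 norm_zero) (intro mult_nonneg_nonneg fact_ge_zero abs_ge_zero)
    qed
    then show "\<forall>\<^sub>F h in at 0. norm (flat_exp n h / h) \<le> fact (n + 2) * \<bar>h\<bar>" by simp
    have "((\<lambda>h::real. fact (n + 2) * \<bar>h\<bar>) \<longlongrightarrow> fact (n + 2) * \<bar>0\<bar>) (at 0)"
      by (intro tendsto_intros)
    then show "((\<lambda>h::real. fact (n + 2) * \<bar>h\<bar>) \<longlongrightarrow> 0) (at 0)" by simp
  qed
  then show ?thesis using equal by (simp add: DERIV_def flat_exp_def)
next
  case greater
  have "((\<lambda>t. exp (- (1 / t)) / t ^ n) has_real_derivative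
      flat_exp (n + 2) t - n * flat_exp (n + 1) t) (at t)"
    using greater
    by (auto intro!: derivative_eq_intros simp: flat_exp_def field_simps power2_eq_square)
      (cases n; simp)
  then show ?thesis
    by (rule has_field_derivative_transform_within[where d = t]) (use greater in \<open>auto simp: flat_exp_def dist_real_def\<close>)
qed

definition bump :: "'a::euclidean_space \<Rightarrow> real \<Rightarrow> 'a \<Rightarrow> real" where
  "bump c r z = flat_exp 0 (r\<^sup>2 - (dist z c)\<^sup>2)"

lemma bump_eq_0_iff:
  assumes "0 < r"
  shows "bump c r z = 0 \<longleftrightarrow> z \<notin> ball c r"
proof -
  have "dist z c < r \<longleftrightarrow> (dist z c)\<^sup>2 < r\<^sup>2"
    using power_mono_iff[of r "dist z c" 2] assms by (simp add: not_le[symmetric])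
  then show ?thesis by (auto simp: bump_def flat_exp_def dist_commute)
qed

lemma Ck_differentiable_bump:
  fixes c :: "'a::euclidean_space"
  shows "Ck_differentiable k (bump c r)"
proof -
  let ?s = "\<lambda>z. r\<^sup>2 - (z - c) \<bullet> (z - c)"
  have s': "(?s has_derivative (\<lambda>v. - 2 * ((z - c) \<bullet> v))) (at z)" for z
    by (auto intro!: derivative_eq_intros simp: inner_commute)
  have lin: "Ck_differentiable k (\<lambda>z. - 2 * ((z - c) \<bullet> v))" for k and v
  proof (cases k)
    case (Suc n)
    have "((\<lambda>z. - 2 * ((z - c) \<bullet> v)) has_derivative (\<lambda>w. - 2 * (w \<bullet> v))) (at z)" for z
      by (auto intro!: derivative_eq_intros)
    then show ?thesis
      unfolding Suc by (subst Ck_differentiable_frechet) (auto intro: Ck_differentiable_const)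
  qed (auto intro!: continuous_intros)
  have "Ck_differentiable k (\<lambda>z. flat_exp n (?s z))" for n
  proof (induction k arbitrary: n)
    case 0
    have "continuous_on UNIV (flat_exp n)"
      using flat_exp_deriv by (blast intro: DERIV_isCont continuous_at_imp_continuous_on)
    then have "continuous_on UNIV (\<lambda>z. flat_exp n (?s z))"
      by (rule continuous_on_compose2) (auto intro!: continuous_intros)
    then show ?case by simp
  next
    case (Suc k)
    have "((\<lambda>z. flat_exp n (?s z)) has_derivative
       (\<lambda>v. (flat_exp (n + 2) (?s z) - n * flat_exp (n + 1) (?s z)) * (- 2 * ((z - c) \<bullet> v)))) (at z)" for z
      using has_derivative_compose[OF s' flat_exp_deriv[unfolded has_field_derivative_def]] by simp
    then show ?case
    proof (subst Ck_differentiable_frechet, assumption, intro allI Ck_differentiable_mult[OF _ lin])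
      have "Ck_differentiable k (\<lambda>x. flat_exp (n + 2) (?s x) + (- real n) * flat_exp (n + 1) (?s x))"
        by (intro Ck_differentiable_add Ck_differentiable_mult Suc Ck_differentiable_const)
      then show "Ck_differentiable k (\<lambda>x. flat_exp (n + 2) (?s x) - n * flat_exp (n + 1) (?s x))" by simp
    qed
  qed
  then show ?thesis by (simp add: bump_def[abs_def] dist_norm power2_norm_eq_inner)
qed

section \<open>Rigid markers\<close>

text \<open>If \<open>A\<close> moves \<open>w\<close>, then \<open>A *v w - w\<close> is orthogonal to all fixed vectors of \<open>A\<close>, because \<open>A\<close> preserves
  inner products.\<close>

lemma orthogonal_fixed_hyperplane:
  fixes A :: "real ^ 'd ^ 'd"
  assumes "orthogonal_matrix A" "A \<noteq> mat 1"
  obtains a where "a \<noteq> 0" "\<And>u. A *v u = u \<Longrightarrow> a \<bullet> u = 0"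
proof -
  obtain w where w: "A *v w \<noteq> w"
    using assms(2) by (metis matrix_eq matrix_vector_mul_lid)
  have "orthogonal_transformation ((*v) A)"
    using assms(1) by (simp add: orthogonal_transformation_matrix)
  then have "(A *v w) \<bullet> (A *v u) = w \<bullet> u" for u
    by (simp add: orthogonal_transformation_def)
  then have "(A *v w - w) \<bullet> u = 0" if "A *v u = u" for u
    using that by (metis cancel_comm_monoid_add_class.diff_cancel inner_diff_left)
  then show ?thesis using that[of "A *v w - w"] w by auto
qed

lemma isom_fixed_hyperplane:
  assumes "g \<in> carrier euclidean_group" "g \<noteq> \<one>\<^bsub>euclidean_group\<^esub>" "isom_apply g p = p"
  obtains a where "a \<noteq> 0" "\<And>x. isom_apply g x = x \<Longrightarrow> a \<bullet> (x - p) = 0"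
proof -
  obtain t A where g: "g = (t, A)" by (cases g)
  have "orthogonal_matrix A" using assms(1) by (simp add: g euclidean_group_def)
  moreover have "A \<noteq> mat 1"
    using assms(2,3) by (auto simp: g euclidean_group_def isom_apply_def)
  ultimately obtain a where a: "a \<noteq> 0" "\<And>u. A *v u = u \<Longrightarrow> a \<bullet> u = 0"
    using orthogonal_fixed_hyperplane by blast
  have "A *v (x - p) = x - p" if "isom_apply g x = x" for x
  proof -
    have "t + A *v x = x" "t + A *v p = p" using that assms(3) by (simp_all add: g isom_apply_def)
    then have "A *v x - A *v p = x - p" by (metis add_diff_cancel_left)
    then show ?thesis by (simp add: matrix_vector_mult_diff_distrib)
  qed
  with a that show ?thesis by blast
qed

text \<open>The points fixed by an isometry other than the identity lie in a hyperplane through \<open>p\<close>. A point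
  of \<open>D\<close> near the tip of a normal vector of length \<open>L\<close> lies off this hyperplane.\<close>

lemma isom_eq_one_if_fixes_relatively_dense:
  assumes g: "g \<in> carrier euclidean_group" "isom_apply g p = p"
    and D: "\<And>x. \<exists>q\<in>D. dist x q < L"
    and fixed: "\<And>q. q \<in> D \<Longrightarrow> dist p q < 2 * L \<Longrightarrow> isom_apply g q = q"
  shows "g = \<one>\<^bsub>euclidean_group\<^esub>"
proof (rule ccontr)
  assume "g \<noteq> \<one>\<^bsub>euclidean_group\<^esub>"
  then obtain a where a: "a \<noteq> 0" "\<And>x. isom_apply g x = x \<Longrightarrow> a \<bullet> (x - p) = 0"
    using isom_fixed_hyperplane[OF g(1) _ g(2)] by blast
  define c where "c = p + (L / norm a) *\<^sub>R a"
  obtain q where q: "q \<in> D" "dist c q < L" using D by blast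
  have L: "L > 0" using q(2) zero_le_dist[of c q] by linarith
  have "dist p c = L" using a(1) L by (simp add: c_def dist_norm)
  then have "dist p q < 2 * L" using q(2) dist_triangle[of p q c] by linarith
  then have 0: "a \<bullet> (q - p) = 0" using a(2) fixed q(1) by blast
  have "a \<bullet> (q - p) = a \<bullet> (q - c) + L * norm a"
    using a(1) by (simp add: c_def inner_diff_right inner_add_right dot_square_norm power2_eq_square)
  moreover have "\<bar>a \<bullet> (q - c)\<bar> \<le> norm a * norm (q - c)" by (rule Cauchy_Schwarz_ineq2)
  moreover have "norm a * norm (q - c) < norm a * L"
    using q(2) a(1) by (simp add: dist_norm norm_minus_commute)
  ultimately show False using 0 by (simp add: mult.commute)
qed

lemma isom_eq_if_agree_on_frame:
  fixes g h :: "('d::finite) isom"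
  assumes "\<delta> \<noteq> 0" "isom_apply g w = isom_apply h w"
    and "\<And>i. isom_apply g (w + \<delta> *\<^sub>R axis i 1) = isom_apply h (w + \<delta> *\<^sub>R axis i 1)"
  shows "g = h"
proof -
  have "snd g *v axis i 1 = snd h *v axis i 1" for i
    using assms(1,2) assms(3)[of i]
    by (simp add: isom_apply_def matrix_vector_right_distrib add.assoc[symmetric] matrix_vector_mult_scaleR)
  then have "snd g = snd h"
    by (simp add: matrix_vector_mult_basis column_def vec_eq_iff)
  then show ?thesis using assms(2) by (simp add: isom_apply_def prod_eq_iff)
qed

text \<open>A marker is a labelled affine frame: its images determine an affine map. It has a length scale
  \<open>\<delta>\<close>: each point lies within \<open>\<delta>\<close> of the point \<open>None\<close>, distinct points are at least \<open>\<delta>\<close> apart, while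
  the copies of the marker under the nontrivial elements of \<open>H\<close> keep a distance of more than \<open>2 * \<delta>\<close>.
  So in a union of copies one can tell which points belong to the same copy.\<close>

definition marker :: "('d::finite) isom set \<Rightarrow> ('d option \<Rightarrow> real ^ 'd) \<Rightarrow> real \<Rightarrow> bool" where
  "marker H y \<delta> \<longleftrightarrow> 0 < \<delta>
     \<and> (\<forall>j j'. j \<noteq> j' \<longrightarrow> \<delta> \<le> dist (y j) (y j'))
     \<and> (\<forall>j. dist (y j) (y None) \<le> \<delta>)
     \<and> (\<forall>h\<in>H. h \<noteq> \<one>\<^bsub>euclidean_group\<^esub> \<longrightarrow> (\<forall>j j'. 2 * \<delta> < dist (isom_apply h (y j)) (y j')))
     \<and> (\<forall>g h. (\<forall>j. isom_apply g (y j) = isom_apply h (y j)) \<longrightarrow> g = h)"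

lemma markerD:
  assumes "marker H y \<delta>"
  shows "0 < \<delta>" "j \<noteq> j' \<Longrightarrow> \<delta> \<le> dist (y j) (y j')" "dist (y j) (y None) \<le> \<delta>"
    "h \<in> H \<Longrightarrow> h \<noteq> \<one>\<^bsub>euclidean_group\<^esub> \<Longrightarrow> 2 * \<delta> < dist (isom_apply h (y j)) (y j')"
    "(\<And>j. isom_apply g (y j) = isom_apply k (y j)) \<Longrightarrow> g = k"
  using assms unfolding marker_def by blast+

text \<open>A point \<open>w\<close> outside finitely many hyperplanes is moved by every nontrivial element of \<open>H\<close>. A
  sufficiently small orthogonal frame at \<open>w\<close> is then a marker.\<close>

lemma ex_marker:
  fixes p :: "real ^ ('d::finite)"
  assumes H: "finite H" "\<And>h. h \<in> H \<Longrightarrow> h \<in> carrier euclidean_group \<and> isom_apply h p = p"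
    and e: "e > 0"
  shows "\<exists>y \<delta>. marker H y \<delta> \<and> (\<forall>j. dist p (y j) < e)"
proof -
  let ?H = "H - {\<one>\<^bsub>euclidean_group\<^esub>}"
  have "\<exists>a. a \<noteq> 0 \<and> (\<forall>x. isom_apply h x = x \<longrightarrow> a \<bullet> (x - p) = 0)" if "h \<in> ?H" for h
    using isom_fixed_hyperplane[of h p] H(2)[of h] that by (metis DiffE singletonI)
  then obtain a where a: "\<And>h. h \<in> ?H \<Longrightarrow> a h \<noteq> 0"
    "\<And>h x. h \<in> ?H \<Longrightarrow> isom_apply h x = x \<Longrightarrow> a h \<bullet> (x - p) = 0"
    by metis
  have "negligible {x. a h \<bullet> (x - p) = 0}" if "h \<in> ?H" for h
    using negligible_hyperplane[of "a h" "a h \<bullet> p"] a(1)[OF that] by (simp add: inner_diff_right)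
  then have "negligible (\<Union>h\<in>?H. {x. a h \<bullet> (x - p) = 0})"
    using H(1) by (intro negligible_Union) auto
  moreover have "\<not> negligible (ball p (e / 2))"
    using e by (intro open_not_negligible) auto
  ultimately obtain w where w: "w \<in> ball p (e / 2)" "w \<notin> (\<Union>h\<in>?H. {x. a h \<bullet> (x - p) = 0})"
    using negligible_subset by blast
  have moved: "isom_apply h w \<noteq> w" if "h \<in> ?H" for h
    using a(2)[OF that] w(2) that by blast
  define m where "m = Min (insert e ((\<lambda>h. dist (isom_apply h w) w) ` ?H))"
  have m: "m > 0" "m \<le> e" "\<And>h. h \<in> ?H \<Longrightarrow> m \<le> dist (isom_apply h w) w"
    using H(1) e moved by (auto simp: m_def)
  define \<delta> where "\<delta> = m / 8"
  define y where "y = case_option w (\<lambda>i. w + \<delta> *\<^sub>R axis i 1)"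
  have y: "y None = w" "y (Some i) = w + \<delta> *\<^sub>R axis i 1" for i by (simp_all add: y_def)
  have \<delta>: "0 < \<delta>" using m by (simp add: \<delta>_def)
  have near: "dist (y j) w \<le> \<delta>" for j
    using \<delta> by (cases j) (simp_all add: y dist_norm)
  have diff: "\<delta> \<le> dist (y j) (y j')" if "j \<noteq> j'" for j j'
  proof -
    have *: "\<delta> \<le> dist (y (Some i)) (y k)" if "k \<noteq> Some i" for i k
    proof -
      have "\<delta> = \<bar>(y (Some i) - y k) $ i\<bar>"
        using \<delta> that by (cases k) (auto simp: y axis_def)
      also have "\<dots> \<le> dist (y (Some i)) (y k)"
        unfolding dist_norm by (rule component_le_norm_cart)
      finally show ?thesis .
    qed
    show ?thesis using *[of j'] *[of j] that by (cases j; cases j') (auto simp: dist_commute)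
  qed
  have far: "2 * \<delta> < dist (isom_apply h (y j)) (y j')" if h: "h \<in> ?H" for h j j'
  proof -
    have "dist (isom_apply h w) (isom_apply h (y j)) \<le> \<delta>"
      using near[of j] h H(2)[of h] by (simp add: isom_dist dist_commute)
    moreover have "dist (y j') w \<le> \<delta>" by (rule near)
    moreover have "8 * \<delta> \<le> dist (isom_apply h w) w" using m(3)[OF h] by (simp add: \<delta>_def)
    ultimately show ?thesis
      using \<delta> dist_triangle[of "isom_apply h w" w "isom_apply h (y j)"]
        dist_triangle[of "isom_apply h (y j)" w "y j'"] by linarith
  qed
  have "marker H y \<delta>"
    unfolding marker_def
  proof (intro conjI allI impI ballI)
    fix g h :: "'d isom" assume "\<forall>j. isom_apply g (y j) = isom_apply h (y j)"
    then show "g = h"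
      using isom_eq_if_agree_on_frame[of \<delta> g w h] \<delta> y by (metis less_irrefl)
  qed (use \<delta> near diff far in \<open>auto simp: y\<close>)
  moreover have "dist p (y j) < e" for j
    using near[of j] w(1) m \<delta> dist_triangle[of p "y j" w] by (simp add: \<delta>_def dist_commute)
  ultimately show ?thesis by blast
qed

text \<open>This provides radii that encode the elements of a countable set, each as small as its place
  requires. Along an enumeration, the running minimum of the bounds divided by \<open>n + 2\<close> is strictly
  decreasing.\<close>

lemma ex_injective_below:
  fixes b :: "'a \<Rightarrow> real"
  assumes "countable A" "\<And>a. a \<in> A \<Longrightarrow> b a > 0"
  shows "\<exists>r. inj_on r A \<and> (\<forall>a\<in>A. 0 < r a \<and> r a < b a)"
proof -
  define c where "c n = (if n \<in> to_nat_on A ` A then b (from_nat_into A n) else 1)" for n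
  define s where "s n = Min (c ` {..n}) / (n + 2)" for n
  have c: "c n > 0" for n
    using assms by (auto simp: c_def)
  have pos: "s n > 0" for n
    using c by (auto simp: s_def intro!: divide_pos_pos)
  have "s (Suc n) < s n" for n
  proof -
    have "Min (c ` {..Suc n}) \<le> Min (c ` {..n})" by (intro Min_antimono) auto
    moreover have "Min (c ` {..n}) > 0" by (simp add: c)
    ultimately show ?thesis
      unfolding s_def by (intro frac_less2) (auto simp: c)
  qed
  then have "s n < s m" if "m < n" for m n
    using lift_Suc_mono_less[of "\<lambda>n. - s n" m n] that by simp
  then have "inj s"
    by (metis injI less_irrefl linorder_neqE_nat)
  have less: "s n < c n" for n
  proof -
    have "Min (c ` {..n}) \<le> c n" by (intro Min_le) auto
    moreover have "c n < c n * (n + 2)" using c[of n] by (simp add: algebra_simps add_pos_nonneg)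
    ultimately have "Min (c ` {..n}) < c n * (n + 2)" by (rule le_less_trans)
    then show ?thesis by (simp add: s_def pos_divide_less_eq)
  qed
  let ?r = "\<lambda>a. s (to_nat_on A a)"
  have "inj_on ?r A"
    using inj_on_to_nat_on[OF assms(1)] \<open>inj s\<close> by (simp add: inj_on_def)
  moreover have "0 < ?r a \<and> ?r a < b a" if "a \<in> A" for a
    using pos less[of "to_nat_on A a"] that assms(1) by (simp add: c_def)
  ultimately show ?thesis by blast
qed

section \<open>Matching points of a pattern\<close>

text \<open>A pattern together with a Delone set \<open>D\<close> derived from it. The radius \<open>r\<close> is so large that an isometry
  that preserves the pattern near \<open>x\<close> up to distance \<open>r\<close> also preserves the points of \<open>D\<close> near \<open>x\<close> up
  to distance \<open>2 * L\<close>; these points are enough to determine the isometry. The choice \<open>s \<le> L\<close> puts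
  everything within distance \<open>s\<close> into this range.\<close>

locale pattern_with_points = isometric_patterns \<Gamma> S
  for \<Gamma> :: "('d::finite) isom set" and S :: "('p, real ^ 'd, 'd isom) pattern_space" +
  fixes P :: 'p and D :: "(real ^ 'd) set" and s L r :: real
  assumes P: "P \<in> carrier S"
    and s: "0 < s" "s \<le> L"
    and separated: "p \<in> D \<Longrightarrow> q \<in> D \<Longrightarrow> p \<noteq> q \<Longrightarrow> s < dist p q"
    and dense: "\<exists>p\<in>D. dist x p < L"
    and points_derivable: "g \<in> \<Gamma> \<Longrightarrow> agree_on (act S g P) P x r \<Longrightarrow>
           isom_apply g ` D \<inter> cball x (2 * L) = D \<inter> cball x (2 * L)"
begin

lemma uniformly_discrete_D: "uniformly_discrete D"
  using s separated by (auto simp: uniformly_discrete_def)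

lemma finite_D: "finite (D \<inter> cball x t)"
  using uniformly_discrete_D by (rule uniformly_discrete_finite)

lemma countable_D: "countable D"
proof -
  have "D \<subseteq> (\<Union>n::nat. D \<inter> cball 0 n)"
    by (auto simp: real_arch_simple)
  moreover have "countable (\<Union>n::nat. D \<inter> cball 0 n)"
    using finite_D by (intro countable_UN[OF countableI_type] countable_finite) auto
  ultimately show ?thesis by (rule countable_subset)
qed

text \<open>The isometries that carry the patch of radius \<open>r\<close> at \<open>p\<close> onto the patch at a point of \<open>D\<close>.
  By \<open>comp_matching_iff\<close> and \<open>inv_matching\<close> they form a groupoid on \<open>D\<close>: its components are
  the classes of points with congruent patches, and its isotropy groups are the symmetry groups of
  the patches.\<close>

definition matching :: "real ^ 'd \<Rightarrow> 'd isom set" where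
  "matching p = {g \<in> \<Gamma>. isom_apply g p \<in> D \<and> agree_on (act S g P) P (isom_apply g p) r}"

lemma matchingD:
  assumes "g \<in> matching p"
  shows "g \<in> \<Gamma>" "isom_apply g p \<in> D" "agree_on (act S g P) P (isom_apply g p) r"
  using assms by (auto simp: matching_def)

lemma one_matching: "p \<in> D \<Longrightarrow> isom_one \<in> matching p"
  by (simp add: matching_def one_closed isom_apply_one act_one P agree_on_refl)

lemma comp_matching_iff:
  assumes g: "g \<in> matching p" and h: "h \<in> \<Gamma>"
  shows "h \<odot> g \<in> matching p \<longleftrightarrow> h \<in> matching (isom_apply g p)"
proof -
  note g' = matchingD[OF g]
  have "agree_on (act S (h \<odot> g) P) (act S h P) (isom_apply (h \<odot> g) p) r"
    using agree_on_act[OF h act_closed[OF g'(1) P] P] g' h P by (simp add: act_comp isom_apply_mult)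
  then have "agree_on (act S (h \<odot> g) P) P (isom_apply (h \<odot> g) p) r \<longleftrightarrow>
      agree_on (act S h P) P (isom_apply (h \<odot> g) p) r"
    by (simp add: agree_on_def)
  then show ?thesis
    using g' h by (simp add: matching_def comp_closed isom_apply_mult)
qed

lemma inv_matching:
  assumes "p \<in> D" "g \<in> matching p"
  shows "isom_inv g \<in> matching (isom_apply g p)"
  using comp_matching_iff[OF assms(2), of "isom_inv g"] assms matchingD[OF assms(2)]
  by (simp add: inv_closed inv_comp one_matching)

lemma matching_nearby:
  assumes g: "g \<in> matching p" and q: "q \<in> D" "dist p q \<le> 2 * L"
  shows "isom_apply g q \<in> D"
proof -
  note g' = matchingD[OF g]
  have "isom_apply g q \<in> isom_apply g ` D \<inter> cball (isom_apply g p) (2 * L)"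
    using q g' by (simp add: dist_isom)
  then show ?thesis using points_derivable[OF g'(1,3)] by blast
qed

text \<open>A matching isometry maps the finite set \<open>D \<inter> cball p (2 * L)\<close> into \<open>D \<inter> cball x (2 * L)\<close> and is
  determined by its restriction to this set.\<close>

lemma finite_matching: "finite {g \<in> matching p. isom_apply g p = x}"
proof -
  let ?T = "{g \<in> matching p. isom_apply g p = x}"
  let ?F = "D \<inter> cball p (2 * L)"
  let ?m = "\<lambda>g. restrict (isom_apply g) ?F"
  have "inj_on ?m ?T"
  proof (rule inj_onI)
    fix g h assume g: "g \<in> ?T" and h: "h \<in> ?T" and eq: "?m g = ?m h"
    have G: "g \<in> \<Gamma>" "h \<in> \<Gamma>" using g h by (blast dest: matchingD(1))+
    have "isom_inv h \<odot> g = isom_one"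
    proof (rule isom_eq_one_if_fixes_relatively_dense[OF _ _ dense])
      show "isom_inv h \<odot> g \<in> carrier euclidean_group"
        using G by (intro carrier comp_closed inv_closed)
      show "isom_apply (isom_inv h \<odot> g) p = p"
        using G g h by (simp add: isom_apply_mult) (metis apply_inv(1))
      show "isom_apply (isom_inv h \<odot> g) q = q" if "q \<in> D" "dist p q < 2 * L" for q
        using fun_cong[OF eq, of q] that G by (simp add: isom_apply_mult apply_inv)
    qed
    then have "h \<odot> (isom_inv h \<odot> g) = h \<odot> isom_one" by simp
    then show "g = h"
      using G carrier by (simp add: comp_inv_cancel monoid.r_one[OF group.is_monoid[OF group_euclidean_group]])
  qed
  moreover have "?m ` ?T \<subseteq> ?F \<rightarrow>\<^sub>E (D \<inter> cball x (2 * L))"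
  proof (rule image_subsetI)
    fix g assume "g \<in> ?T"
    then have g: "g \<in> matching p" "isom_apply g p = x" by simp_all
    have "isom_apply g q \<in> D \<inter> cball x (2 * L)" if "q \<in> ?F" for q
      using matching_nearby[OF g(1), of q] dist_isom[OF matchingD(1)[OF g(1)], of p q] g(2) that by simp
    then show "?m g \<in> ?F \<rightarrow>\<^sub>E (D \<inter> cball x (2 * L))" by (simp add: restrict_PiE_iff)
  qed
  ultimately show ?thesis
    using finite_D by (meson finite_PiE finite_imageD finite_subset)
qed

text \<open>Points in the same class get the same representative, since the predicate depends on the class
  only.\<close>

definition representative :: "real ^ 'd \<Rightarrow> real ^ 'd" where
  "representative x = (SOME p. p \<in> D \<and> (\<exists>g\<in>matching p. isom_apply g p = x))"

lemma representative:
  assumes "x \<in> D"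
  shows "representative x \<in> D" "\<exists>g\<in>matching (representative x). isom_apply g (representative x) = x"
proof -
  have "\<exists>p. p \<in> D \<and> (\<exists>g\<in>matching p. isom_apply g p = x)"
    using one_matching[OF assms] assms by (metis isom_apply_one)
  from someI_ex[OF this]
  show "representative x \<in> D" "\<exists>g\<in>matching (representative x). isom_apply g (representative x) = x"
    by (auto simp: representative_def)
qed

lemma representative_matching:
  assumes "x \<in> D" "h \<in> matching x"
  shows "representative (isom_apply h x) = representative x"
proof -
  note h = matchingD[OF assms(2)]
  have "(\<exists>g\<in>matching p. isom_apply g p = isom_apply h x) \<longleftrightarrow> (\<exists>g\<in>matching p. isom_apply g p = x)" for p
  proof
    assume "\<exists>g\<in>matching p. isom_apply g p = x"
    then obtain g where g: "g \<in> matching p" "isom_apply g p = x" by blast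
    then have "h \<odot> g \<in> matching p" using comp_matching_iff h(1) assms(2) by simp
    then show "\<exists>g\<in>matching p. isom_apply g p = isom_apply h x"
      using g(2) isom_apply_mult by metis
  next
    assume "\<exists>g\<in>matching p. isom_apply g p = isom_apply h x"
    then obtain g where g: "g \<in> matching p" "isom_apply g p = isom_apply h x" by blast
    then have "isom_inv h \<odot> g \<in> matching p"
      using comp_matching_iff[OF g(1) inv_closed[OF h(1)]] inv_matching[OF assms] by simp
    then show "\<exists>g\<in>matching p. isom_apply g p = x"
      using g(2) h(1) by (metis apply_inv(1) isom_apply_mult)
  qed
  then show ?thesis by (simp add: representative_def)
qed

lemma representative_eq_if_matching:
  assumes "p \<in> representative ` D" "g \<in> matching p"
  shows "p \<in> D" "representative (isom_apply g p) = p"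
proof -
  obtain x where x: "x \<in> D" "p = representative x" using assms by blast
  then obtain h where h: "h \<in> matching p" "isom_apply h p = x" using representative by blast
  show p: "p \<in> D" using x representative by simp
  have "representative p = p" using representative_matching[OF p h(1)] h(2) x(2) by simp
  then show "representative (isom_apply g p) = p" using representative_matching[OF p assms(2)] by simp
qed

end

text \<open>This is how the individual balls are recovered from their union.\<close>

lemma connected_in_disjoint_open_family:
  assumes "connected X" "x \<in> X" "X \<subseteq> (\<Union>i\<in>I. U i)" "\<And>i. i \<in> I \<Longrightarrow> open (U i)"
    and "\<And>i j z. i \<in> I \<Longrightarrow> j \<in> I \<Longrightarrow> z \<in> U i \<Longrightarrow> z \<in> U j \<Longrightarrow> i = j"
    and "i \<in> I" "x \<in> U i"
  shows "X \<subseteq> U i"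
proof -
  let ?V = "\<Union>j\<in>I - {i}. U j"
  have "open (U i)" "open ?V" using assms by auto
  moreover have "X \<subseteq> U i \<union> ?V" using assms(3) by blast
  moreover have "U i \<inter> ?V = {}" using assms(5,6) by blast
  moreover have "U i \<inter> X \<noteq> {}" using assms by blast
  ultimately have "?V \<inter> X = {}"
    using assms(1) unfolding connected_def by (metis inf.assoc inf_bot_left inf_commute)
  then show ?thesis using \<open>X \<subseteq> U i \<union> ?V\<close> by blast
qed

section \<open>The code of a pattern\<close>

text \<open>Every point \<open>p\<close> gets a marker \<open>y p\<close> within \<open>s / 8\<close> that distinguishes the symmetries of its patch. The
  radius \<open>rad p j\<close> names the point \<open>p\<close> and the label \<open>j\<close>. The bounds on the radii keep all balls
  disjoint.\<close>

locale marked_pattern = pattern_with_points \<Gamma> S P D s L r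
  for \<Gamma> :: "('d::finite) isom set" and S :: "('p, real ^ 'd, 'd isom) pattern_space"
    and P D s L r +
  fixes y :: "real ^ 'd \<Rightarrow> 'd option \<Rightarrow> real ^ 'd" and \<delta> :: "real ^ 'd \<Rightarrow> real"
    and rad :: "real ^ 'd \<Rightarrow> 'd option \<Rightarrow> real"
    and \<psi> :: "'d isom \<Rightarrow> complex ^ ('m::finite) ^ 'm" and v :: "complex ^ 'm"
  assumes mark: "p \<in> D \<Longrightarrow> marker {g \<in> matching p. isom_apply g p = p} (y p) (\<delta> p)"
    and near: "p \<in> D \<Longrightarrow> dist p (y p j) < s / 8"
    and rad_pos: "p \<in> D \<Longrightarrow> 0 < rad p j"
    and rad_less: "p \<in> D \<Longrightarrow> rad p j < \<delta> p / 2" "p \<in> D \<Longrightarrow> rad p j < s / 8"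
    and rad_inj: "p \<in> D \<Longrightarrow> p' \<in> D \<Longrightarrow> rad p j = rad p' j' \<Longrightarrow> p = p' \<and> j = j'"
    and \<psi>_comp: "g \<in> \<Gamma> \<Longrightarrow> h \<in> \<Gamma> \<Longrightarrow> \<psi> (g \<odot> h) = \<psi> g ** \<psi> h"
    and \<psi>_inv: "g \<in> \<Gamma> \<Longrightarrow> invertible (\<psi> g)"
    and v: "v \<noteq> 0"
begin

text \<open>For each representative \<open>p\<close>, the balls around the marker \<open>y p\<close> are copied by all matching isometries,
  so that the balls near a point \<open>x\<close> of \<open>D\<close> are arranged with the symmetry of the patch at \<open>x\<close>.\<close>

definition index :: "((real ^ 'd) \<times> 'd option \<times> 'd isom) set" where
  "index = {(p, j, g). p \<in> representative ` D \<and> g \<in> matching p}"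

definition cell :: "(real ^ 'd) \<times> 'd option \<times> 'd isom \<Rightarrow> (real ^ 'd) set" where
  "cell = (\<lambda>(p, j, g). ball (isom_apply g (y p j)) (rad p j))"

definition blob :: "(real ^ 'd) \<times> 'd option \<times> 'd isom \<Rightarrow> real ^ 'd \<Rightarrow> complex ^ 'm" where
  "blob = (\<lambda>(p, j, g) z. bump (isom_apply g (y p j)) (rad p j) z *\<^sub>R (\<psi> g *v v))"

text \<open>At most one summand is present, by \<open>cells_disjoint\<close>.\<close>

definition code :: "real ^ 'd \<Rightarrow> complex ^ 'm" where
  "code z = (\<Sum>i\<in>{i \<in> index. z \<in> cell i}. blob i z)"

lemma indexD:
  assumes "(p, j, g) \<in> index"
  shows "p \<in> D" "g \<in> matching p" "g \<in> \<Gamma>" "isom_apply g p \<in> D" "representative (isom_apply g p) = p"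
proof -
  have i: "p \<in> representative ` D" "g \<in> matching p" using assms by (simp_all add: index_def)
  then show "p \<in> D" "g \<in> matching p" "g \<in> \<Gamma>" "isom_apply g p \<in> D" "representative (isom_apply g p) = p"
    using representative_eq_if_matching[OF i] matchingD[OF i(2)] by simp_all
qed

lemma open_cell: "open (cell i)"
  by (cases i) (simp add: cell_def)

lemma cell_subset:
  assumes "(p, j, g) \<in> index"
  shows "cell (p, j, g) \<subseteq> ball (isom_apply g p) (s / 4)"
proof
  fix z assume "z \<in> cell (p, j, g)"
  moreover have "dist (isom_apply g p) (isom_apply g (y p j)) < s / 8"
    using near[of p j] indexD[OF assms] by (simp add: dist_isom)
  ultimately show "z \<in> ball (isom_apply g p) (s / 4)"
    using rad_less(2)[of p j] indexD[OF assms] dist_triangle[of "isom_apply g p" z "isom_apply g (y p j)"]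
    by (simp add: cell_def)
qed

text \<open>The second inequality implies that both copies belong to the same point of \<open>D\<close>. Then \<open>g\<close> and \<open>h\<close>
  differ by a symmetry of the patch at \<open>p\<close>, and the marker separates its copies under nontrivial
  symmetries.\<close>

lemma matching_eq_if_marks_close:
  assumes p: "p \<in> D" and g: "g \<in> matching p" and h: "h \<in> matching p"
    and close: "dist (isom_apply g (y p j)) (isom_apply h (y p j')) \<le> \<delta> p"
      "dist (isom_apply g (y p j)) (isom_apply h (y p j')) < s / 2"
  shows "g = h"
proof -
  note g' = matchingD[OF g] and h' = matchingD[OF h]
  have "dist (isom_apply g p) (isom_apply g (y p j)) < s / 8"
      "dist (isom_apply h p) (isom_apply h (y p j')) < s / 8"
    using near[OF p] g' h' by (simp_all add: dist_isom)
  then have "dist (isom_apply g p) (isom_apply h p) < s"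
    using close(2) dist_triangle[of "isom_apply g p" "isom_apply h p" "isom_apply g (y p j)"]
      dist_triangle[of "isom_apply g (y p j)" "isom_apply h p" "isom_apply h (y p j')"] s(1)
    by (simp add: dist_commute)
  then have eq: "isom_apply g p = isom_apply h p"
    using separated[OF g'(2) h'(2)] by fastforce
  let ?k = "isom_inv h \<odot> g"
  have "?k \<in> matching p"
    using comp_matching_iff[OF g inv_closed[OF h'(1)]] inv_matching[OF p h] eq by simp
  moreover have "isom_apply ?k p = p"
    using h'(1) eq by (simp add: isom_apply_mult apply_inv)
  moreover have "dist (isom_apply ?k (y p j)) (y p j') \<le> \<delta> p"
    using close(1) h'(1) by (simp add: isom_apply_mult dist_isom_inv)
  ultimately have "?k = isom_one"
    using markerD(4)[OF mark[OF p], of ?k j j'] markerD(1)[OF mark[OF p]] by fastforce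
  then have "h \<odot> ?k = h \<odot> isom_one" by simp
  then show "g = h"
    using g' h' carrier by (simp add: comp_inv_cancel monoid.r_one[OF group.is_monoid[OF group_euclidean_group]])
qed

lemma cells_disjoint:
  assumes i: "i \<in> index" "i' \<in> index" and z: "z \<in> cell i" "z \<in> cell i'"
  shows "i = i'"
proof -
  obtain p j g p' j' g' where eq: "i = (p, j, g)" "i' = (p', j', g')" by (metis prod_cases3)
  note I = indexD[OF i(1)[unfolded eq]] and I' = indexD[OF i(2)[unfolded eq]]
  have "dist (isom_apply g p) (isom_apply g' p') < s"
    using cell_subset[OF i(1)[unfolded eq]] cell_subset[OF i(2)[unfolded eq]] z s(1)
      dist_triangle[of "isom_apply g p" "isom_apply g' p'" z] unfolding eq by (force simp: dist_commute)
  then have "isom_apply g p = isom_apply g' p'"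
    using separated[OF I(4) I'(4)] by fastforce
  then have p: "p' = p" using I(5) I'(5) by simp
  have d: "dist (isom_apply g (y p j)) (isom_apply g' (y p j')) < rad p j + rad p j'"
    using z dist_triangle[of "isom_apply g (y p j)" "isom_apply g' (y p j')" z]
    by (simp add: eq p cell_def dist_commute)
  have g: "g = g'"
    by (rule matching_eq_if_marks_close[OF I(1,2) I'(2)[unfolded p], of j j'])
      (use d rad_less[OF I(1), of j] rad_less[OF I(1), of j'] s(1) in linarith)+
  have "dist (y p j) (y p j') < \<delta> p"
    using d rad_less[OF I(1), of j] rad_less[OF I(1), of j'] I(3) by (simp add: g[symmetric] dist_isom)
  then have "j = j'"
    using markerD(2)[OF mark[OF I(1)], of j j'] by linarith
  with p g eq show ?thesis by simp
qed

lemma code_in_cell: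
  assumes "i \<in> index" "z \<in> cell i"
  shows "code z = blob i z"
proof -
  have "{i \<in> index. z \<in> cell i} = {i}" using assms cells_disjoint by blast
  then show ?thesis by (simp add: code_def)
qed

lemma \<psi>_mult_eq_0_iff:
  assumes "g \<in> \<Gamma>"
  shows "\<psi> g *v w = 0 \<longleftrightarrow> w = 0"
proof
  assume 0: "\<psi> g *v w = 0"
  obtain B where "B ** \<psi> g = mat 1"
    using \<psi>_inv[OF assms] by (auto simp: invertible_def)
  then have "w = B *v (\<psi> g *v w)" by (simp add: matrix_vector_mul_assoc)
  then show "w = 0" by (simp add: 0)
qed simp

lemma code_nonzero_iff: "code z \<noteq> 0 \<longleftrightarrow> z \<in> (\<Union>i\<in>index. cell i)"
proof
  show "z \<in> (\<Union>i\<in>index. cell i)" if "code z \<noteq> 0"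
    using that by (auto simp: code_def) (metis (mono_tags, lifting) mem_Collect_eq sum.neutral)
next
  assume "z \<in> (\<Union>i\<in>index. cell i)"
  then obtain p j g where i: "(p, j, g) \<in> index" "z \<in> cell (p, j, g)" by (metis UN_E prod_cases3)
  have "\<psi> g *v v \<noteq> 0"
    using v \<psi>_mult_eq_0_iff[OF indexD(3)[OF i(1)]] by simp
  moreover have "bump (isom_apply g (y p j)) (rad p j) z \<noteq> 0"
    using i(2) rad_pos[OF indexD(1)[OF i(1)]] by (simp add: bump_eq_0_iff cell_def)
  ultimately show "code z \<noteq> 0"
    using code_in_cell[OF i] by (simp add: blob_def)
qed

lemma cell_comp: "k \<in> \<Gamma> \<Longrightarrow> z \<in> cell (p, j, k \<odot> g) \<longleftrightarrow> isom_apply (isom_inv k) z \<in> cell (p, j, g)"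
  by (simp add: cell_def isom_apply_mult dist_isom_inv dist_commute)

lemma mult_scaleR: "\<psi> g *v (t *\<^sub>R w) = t *\<^sub>R (\<psi> g *v w)"
  by (simp add: vec_eq_iff matrix_vector_mult_def scaleR_sum_right)

lemma blob_comp:
  assumes "k \<in> \<Gamma>" "g \<in> \<Gamma>"
  shows "blob (p, j, k \<odot> g) z = \<psi> k *v blob (p, j, g) (isom_apply (isom_inv k) z)"
  using assms
  by (simp add: blob_def bump_def isom_apply_mult dist_isom_inv \<psi>_comp
      matrix_vector_mul_assoc[symmetric] mult_scaleR)

text \<open>If \<open>k\<close> preserves the pattern near \<open>z\<close>, then \<open>k\<close> and its inverse are matching for the relevant points of
  \<open>D\<close>, and composition with them permutes the index set.\<close>

lemma code_derivable:
  assumes k: "k \<in> \<Gamma>" and agree: "agree_on (act S k P) P z (r + s)"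
  shows "\<psi> k *v code (isom_apply (isom_inv k) z) = code z"
proof -
  have kP: "act S k P \<in> carrier S" using k P by (rule act_closed)
  have agree': "agree_on (act S k P) P x r" if "dist z x \<le> s" for x
    using agree_on_smaller[OF agree kP P] that by simp
  have pts: "isom_apply k ` D \<inter> cball z (2 * L) = D \<inter> cball z (2 * L)"
    using agree' s by (intro points_derivable k) simp
  \<comment> \<open>The case that the preimage of \<open>z\<close> lies in a cell. If \<open>z\<close> itself lies in a cell, then so
    does its preimage, as shown at the end.\<close>
  have nz: "\<psi> k *v code (isom_apply (isom_inv k) z) = code z"
    if i: "(p, j, g) \<in> index" and z: "isom_apply (isom_inv k) z \<in> cell (p, j, g)" for p j g
  proof -
    let ?x = "isom_apply g p"
    have d: "dist z (isom_apply k ?x) \<le> s" "dist z (isom_apply k ?x) \<le> 2 * L"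
      using subsetD[OF cell_subset[OF i] z] s
      by (simp_all add: dist_isom_inv[OF k] dist_commute[of z])
    then have "isom_apply k ?x \<in> isom_apply k ` D \<inter> cball z (2 * L)"
      using indexD(4)[OF i] by simp
    then have "isom_apply k ?x \<in> D"
      using pts by blast
    then have "k \<in> matching ?x"
      using k agree'[OF d(1)] by (simp add: matching_def)
    then have i': "(p, j, k \<odot> g) \<in> index"
      using comp_matching_iff[OF indexD(2)[OF i] k] i by (simp add: index_def)
    show ?thesis
      using code_in_cell[OF i z] code_in_cell[OF i'] z k indexD(3)[OF i]
      by (simp add: cell_comp blob_comp)
  qed
  show ?thesis
  proof (cases "code z = 0")
    case True
    show ?thesis
    proof (cases "code (isom_apply (isom_inv k) z) = 0")
      case False
      then show ?thesis using nz code_nonzero_iff by (metis UN_E prod_cases3)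
    qed (simp add: True)
  next
    case False
    then obtain p j g where i: "(p, j, g) \<in> index" and z: "z \<in> cell (p, j, g)"
      using code_nonzero_iff by (metis UN_E prod_cases3)
    let ?x = "isom_apply g p"
    have d: "dist z ?x \<le> s" "dist z ?x \<le> 2 * L"
      using subsetD[OF cell_subset[OF i] z] s by (simp_all add: dist_commute[of z])
    have "?x \<in> D \<inter> cball z (2 * L)"
      using d(2) indexD(4)[OF i] by simp
    then have "?x \<in> isom_apply k ` D"
      using pts by blast
    then have "isom_apply (isom_inv k) ?x \<in> D"
      using k by (simp add: isom_image_eq)
    moreover have "agree_on (act S (isom_inv k) P) P (isom_apply (isom_inv k) ?x) r"
      using agree_on_act[OF inv_closed[OF k] kP P, of ?x r] agree'[OF d(1)] k P
      by (simp add: act_inv agree_on_sym)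
    ultimately have "isom_inv k \<in> matching ?x"
      using k by (simp add: matching_def inv_closed)
    then have "(p, j, isom_inv k \<odot> g) \<in> index"
      using comp_matching_iff[OF indexD(2)[OF i] inv_closed[OF k]] i by (simp add: index_def)
    moreover have "isom_apply (isom_inv k) z \<in> cell (p, j, isom_inv k \<odot> g)"
      using z k indexD(3)[OF i] by (simp add: cell_comp[symmetric] comp_inv_cancel)
    ultimately show ?thesis by (rule nz)
  qed
qed

text \<open>The function is decoded from the set where it is nonzero. If \<open>k\<close>
  preserves it near \<open>x\<close>, connectedness shows that \<open>k\<close> carries balls to balls of the same radius, hence
  with the same \<open>p\<close> and \<open>j\<close>. So the copy of the marker near \<open>x\<close> is the image of points from copies
  given by \<open>G j\<close>. As these points are close together they belong to one copy, and as a marker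
  is an affine frame, \<open>k\<close> composed with \<open>G None\<close> is the matching isometry for \<open>x\<close>. Hence \<open>k\<close> itself is
  matching.\<close>

lemma pattern_derivable:
  assumes k: "k \<in> \<Gamma>"
    and eq: "\<And>z. dist x z \<le> s \<Longrightarrow> \<psi> k *v code (isom_apply (isom_inv k) z) = code z"
    and x: "x \<in> D"
  shows "agree_on (act S k P) P x r"
proof -
  let ?p = "representative x"
  note p = representative(1)[OF x]
  obtain g' where g': "g' \<in> matching ?p" "isom_apply g' ?p = x" using representative(2)[OF x] by blast
  have nz: "code z \<noteq> 0 \<longleftrightarrow> code (isom_apply (isom_inv k) z) \<noteq> 0" if "dist x z \<le> s" for z
    using eq[OF that] \<psi>_mult_eq_0_iff[OF k] by metis
  have conn: "X \<subseteq> cell i" if "connected X" "X \<subseteq> {z. code z \<noteq> 0}" "z \<in> X" "z \<in> cell i" "i \<in> index" for X z i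
  proof (rule connected_in_disjoint_open_family[of X z cell index i])
    show "X \<subseteq> (\<Union>i\<in>index. cell i)" using that(2) code_nonzero_iff by blast
  qed (use that open_cell cells_disjoint in blast)+
  have "\<exists>g\<in>matching ?p. isom_apply k (isom_apply g (y ?p j)) = isom_apply g' (y ?p j)" for j
  proof -
    let ?i = "(?p, j, g')"
    let ?c = "isom_apply g' (y ?p j)"
    have i: "?i \<in> index" using x g' by (simp add: index_def)
    have sub: "cell ?i \<subseteq> ball x (s / 4)" using cell_subset[OF i] g'(2) by simp
    have U: "cell ?i = ball ?c (rad ?p j)" by (simp add: cell_def)
    have c: "?c \<in> cell ?i" using rad_pos[OF p] by (simp add: U)
    \<comment> \<open>The preimage of the ball lies in one ball of the family, the image of which meets, hence lies
      in, the given ball.\<close>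
    let ?V = "isom_apply (isom_inv k) ` cell ?i"
    have V_nz: "?V \<subseteq> {z. code z \<noteq> 0}"
    proof (rule image_subsetI)
      fix z assume z: "z \<in> cell ?i"
      then have "dist x z \<le> s" using subsetD[OF sub z] s(1) by simp
      moreover have "code z \<noteq> 0" unfolding code_nonzero_iff using z i by blast
      ultimately show "isom_apply (isom_inv k) z \<in> {z. code z \<noteq> 0}" using nz by simp
    qed
    have c': "isom_apply (isom_inv k) ?c \<in> ?V" using c by (rule imageI)
    then obtain i2 where "i2 \<in> index" "isom_apply (isom_inv k) ?c \<in> cell i2"
      using subsetD[OF V_nz c'] unfolding mem_Collect_eq code_nonzero_iff by (elim UN_E)
    moreover obtain p2 j2 g where "i2 = (p2, j2, g)" by (rule prod_cases3)
    ultimately have i2: "(p2, j2, g) \<in> index"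
      and c2: "isom_apply (isom_inv k) ?c \<in> cell (p2, j2, g)" by simp_all
    have "connected ?V" unfolding U by (intro connected_isom_image) simp
    then have V: "?V \<subseteq> cell (p2, j2, g)" by (rule conn[OF _ V_nz c' c2 i2])
    let ?W = "isom_apply k ` cell (p2, j2, g)"
    have W: "?W = ball (isom_apply k (isom_apply g (y p2 j2))) (rad p2 j2)"
      using k by (simp add: cell_def isom_image_ball)
    have cW: "?c \<in> ?W" using c2 k by (simp add: isom_image_eq)
    have "?W \<subseteq> {z. code z \<noteq> 0}"
    proof
      fix z assume z: "z \<in> ?W"
      have "dist x ?c < s / 4" using c sub by auto
      moreover have "dist ?c z < s / 4"
        using z cW unfolding W using rad_less(2)[OF indexD(1)[OF i2], of j2]
          dist_triangle[of ?c z "isom_apply k (isom_apply g (y p2 j2))"] by (simp add: dist_commute)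
      ultimately have "dist x z \<le> s" using dist_triangle[of x z ?c] s(1) by simp
      moreover have "code (isom_apply (isom_inv k) z) \<noteq> 0"
        unfolding code_nonzero_iff using z i2 isom_image_eq[OF k] by blast
      ultimately show "z \<in> {z. code z \<noteq> 0}" using nz by simp
    qed
    then have "?W \<subseteq> cell ?i"
      using conn[OF _ _ cW c i] connected_ball by (simp add: W)
    moreover have "cell ?i \<subseteq> ?W"
      using V k by (auto simp: isom_image_eq)
    ultimately have "ball (isom_apply k (isom_apply g (y p2 j2))) (rad p2 j2) = ball ?c (rad ?p j)"
      using W U by blast
    then have "isom_apply k (isom_apply g (y p2 j2)) = ?c" "rad p2 j2 = rad ?p j"
      using rad_pos[OF p, of j] rad_pos[OF indexD(1)[OF i2], of j2] by (auto simp: ball_eq_ball_iff)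
    then show ?thesis
      using rad_inj[OF indexD(1)[OF i2] p] indexD(2)[OF i2] by auto
  qed
  then obtain G where G: "\<And>j. G j \<in> matching ?p"
      "\<And>j. isom_apply k (isom_apply (G j) (y ?p j)) = isom_apply g' (y ?p j)"
    by metis
  have G_eq: "G j = G None" for j
  proof (rule matching_eq_if_marks_close[OF p G(1) G(1), where j = j and j' = None])
    have d: "dist (isom_apply (G j) (y ?p j)) (isom_apply (G None) (y ?p None)) = dist (y ?p j) (y ?p None)"
      using dist_isom[OF k] dist_isom[OF matchingD(1)[OF g'(1)]] G(2) by metis
    show "dist (isom_apply (G j) (y ?p j)) (isom_apply (G None) (y ?p None)) \<le> \<delta> ?p"
      unfolding d by (rule markerD(3)[OF mark[OF p]])
    show "dist (isom_apply (G j) (y ?p j)) (isom_apply (G None) (y ?p None)) < s / 2"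
      unfolding d using near[OF p, of j] near[OF p, of None] s(1)
        dist_triangle[of "y ?p j" "y ?p None" ?p] by (simp add: dist_commute)
  qed
  have "isom_apply (k \<odot> G None) (y ?p j) = isom_apply g' (y ?p j)" for j
    unfolding isom_apply_mult G_eq[of j, symmetric] by (rule G(2))
  then have kG: "k \<odot> G None = g'"
    by (rule markerD(5)[OF mark[OF p]])
  then have "k \<in> matching (isom_apply (G None) ?p)"
    using comp_matching_iff[OF G(1)[of None] k] g'(1) by simp
  moreover have "isom_apply k (isom_apply (G None) ?p) = x"
    using kG g'(2) by (simp add: isom_apply_mult[symmetric])
  ultimately show ?thesis using matchingD(3) by metis
qed

text \<open>The cells near \<open>z\<close> belong to finitely many points of \<open>D\<close>, each with finitely many matching
  isometries. So near \<open>z\<close> the function is a finite sum of bump functions.\<close>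

lemma finite_cells_near: "finite {i \<in> index. cell i \<inter> ball z s \<noteq> {}}"
proof -
  let ?T = "\<lambda>x. {representative x} \<times> (UNIV :: 'd option set) \<times> {g \<in> matching (representative x). isom_apply g (representative x) = x}"
  have "{i \<in> index. cell i \<inter> ball z s \<noteq> {}} \<subseteq> (\<Union>x\<in>D \<inter> cball z (2 * s). ?T x)"
  proof (rule subsetI)
    fix i' assume "i' \<in> {i \<in> index. cell i \<inter> ball z s \<noteq> {}}"
    moreover obtain p j g where i': "i' = (p, j, g)" by (metis prod_cases3)
    ultimately obtain z' where i: "(p, j, g) \<in> index" and z': "z' \<in> cell (p, j, g)" "z' \<in> ball z s"
      by blast
    have "dist z (isom_apply g p) \<le> 2 * s"
      using subsetD[OF cell_subset[OF i] z'(1)] z'(2) s(1) dist_triangle[of z "isom_apply g p" z'] by (simp add: dist_commute)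
    then show "i' \<in> (\<Union>x\<in>D \<inter> cball z (2 * s). ?T x)"
      unfolding i' using indexD[OF i] by (intro UN_I[of "isom_apply g p"]) auto
  qed
  moreover have "finite (\<Union>x\<in>D \<inter> cball z (2 * s). ?T x)"
    by (intro finite_UN_I finite_D finite_cartesian_product finite_matching) simp_all
  ultimately show ?thesis by (rule finite_subset)
qed

lemma code_smooth: "smooth (\<lambda>z. hermitian_inner (code z) u)"
  unfolding smooth_def
proof (intro allI Ck_differentiable_local)
  fix k x
  let ?J = "{i \<in> index. cell i \<inter> ball x s \<noteq> {}}"
  let ?h = "\<lambda>z. \<Sum>(p, j, g)\<in>?J. bump (isom_apply g (y p j)) (rad p j) z *\<^sub>R hermitian_inner (\<psi> g *v v) u"
  have "hermitian_inner (code z) u = ?h z" if z: "z \<in> ball x s" for z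
  proof -
    have zero: "blob i z = 0" if "i \<in> ?J - {i \<in> index. z \<in> cell i}" for i
    proof -
      obtain p j g where "i = (p, j, g)" by (metis prod_cases3)
      then show ?thesis
        using that rad_pos[OF indexD(1), of p j g j] by (auto simp: blob_def cell_def bump_eq_0_iff)
    qed
    have "code z = (\<Sum>i\<in>?J. blob i z)"
      unfolding code_def by (rule sum.mono_neutral_left) (use finite_cells_near z zero in auto)
    moreover have "hermitian_inner (\<Sum>i\<in>?J. blob i z) u = (\<Sum>i\<in>?J. hermitian_inner (blob i z) u)"
      by (simp add: hermitian_inner_def sum_distrib_right sum.swap[of _ UNIV])
    moreover have "hermitian_inner (t *\<^sub>R w) u = t *\<^sub>R hermitian_inner w u" for t w
      by (simp add: hermitian_inner_def scaleR_sum_right)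
    ultimately show ?thesis
      by (auto simp: blob_def case_prod_unfold)
  qed
  moreover have "Ck_differentiable k ?h"
    unfolding case_prod_unfold
    by (intro Ck_differentiable_sum Ck_differentiable_bounded_linear[OF bounded_linear_scaleR_left] Ck_differentiable_bump)
  ultimately show "\<exists>U h. open U \<and> x \<in> U \<and> Ck_differentiable k h \<and> (\<forall>z\<in>U. hermitian_inner (code z) u = h z)"
    using s(1) by (intro exI[of _ "ball x s"] exI[of _ ?h]) auto
qed

end

section \<open>Derivability between a pattern and its code\<close>

lemma map_space_isometric:
  assumes "subgroup \<Gamma> euclidean_group" "\<And>a. (a, mat 1) \<in> \<Gamma>" "\<phi> \<in> hom (isom_group (isotropy \<Gamma>)) GL"
  shows "isometric_patterns \<Gamma> (map_space (\<phi> \<circ> isom_proj))"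
  using assms map_space_over[OF assms]
  by (intro isometric_patterns.intro isometry_group.intro isometric_patterns_axioms.intro)

lemma isotropy_hom:
  fixes \<Gamma> :: "('d::finite) isom set"
  assumes "isometry_group \<Gamma>" and \<phi>: "\<phi> \<in> hom (isom_group (isotropy \<Gamma>)) GL"
  shows "g \<in> \<Gamma> \<Longrightarrow> invertible ((\<phi> \<circ> isom_proj) g)"
    and "g \<in> \<Gamma> \<Longrightarrow> h \<in> \<Gamma> \<Longrightarrow> (\<phi> \<circ> isom_proj) (g \<odot> h) = (\<phi> \<circ> isom_proj) g ** (\<phi> \<circ> isom_proj) h"
proof -
  interpret isometry_group \<Gamma> by fact
  have proj: "isom_proj g \<in> isotropy \<Gamma>" if "g \<in> \<Gamma>" for g
  proof -
    have "(- fst g, mat 1) \<odot> g = isom_proj g"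
      by (cases g) (simp add: isom_proj_def euclidean_group_def)
    then have "isom_proj g \<in> \<Gamma>"
      using comp_closed[OF translation that] by metis
    then show ?thesis by (simp add: isotropy_iff isom_proj_def)
  qed
  show "invertible ((\<phi> \<circ> isom_proj) g)" if "g \<in> \<Gamma>"
    using hom_in_carrier[OF \<phi>, of "isom_proj g"] proj[OF that] by (simp add: GL_def)
  have "isom_proj (g \<odot> h) = isom_proj g \<odot> isom_proj h"
    by (cases g; cases h) (simp add: isom_proj_def euclidean_group_def)
  then show "(\<phi> \<circ> isom_proj) (g \<odot> h) = (\<phi> \<circ> isom_proj) g ** (\<phi> \<circ> isom_proj) h"
    if "g \<in> \<Gamma>" "h \<in> \<Gamma>"
    using hom_mult[OF \<phi>, of "isom_proj g" "isom_proj h"] proj that by (simp add: GL_def)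
qed

lemma map_space_cut_eq_iff:
  "cut (map_space \<psi>) f C = cut (map_space \<psi>) g C \<longleftrightarrow> (\<forall>z\<in>C. f z = g z)"
  by (auto simp: map_space_def fun_eq_iff)

lemma (in marked_pattern) code_mutually_derivable:
  fixes \<rho> :: real
  assumes gl: "glueable S" and \<rho>: "component_radius S P \<rho>" and r: "\<rho> + L \<le> r" "0 \<le> r"
  shows "pointwise_derivable \<Gamma> S P (map_space \<psi>) code (r + s)"
    and "pointwise_derivable \<Gamma> (map_space \<psi>) code S P (r + s)"
proof -
  have act: "act (map_space \<psi>) g code z = \<psi> g *v code (isom_apply (isom_inv g) z)" for g z
    by (simp add: map_space_def)
  show "pointwise_derivable \<Gamma> S P (map_space \<psi>) code (r + s)"
    unfolding pointwise_derivable_def map_space_cut_eq_iff agree_on_def[symmetric] act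
  proof (intro ballI allI impI)
    fix g x z and R :: real
    assume g: "g \<in> \<Gamma>" and "0 \<le> R" and ag: "agree_on (act S g P) P x (R + (r + s))" and z: "z \<in> cball x R"
    have "agree_on (act S g P) P z (r + s)"
      using agree_on_smaller[OF ag act_closed[OF g P] P] z by simp
    then show "\<psi> g *v code (isom_apply (isom_inv g) z) = code z"
      by (rule code_derivable[OF g])
  qed
  \<comment> \<open>All patches with centre up to \<open>R + r\<close> are compared, and each is decoded within distance \<open>s\<close>.\<close>
  show "pointwise_derivable \<Gamma> (map_space \<psi>) code S P (r + s)"
    unfolding pointwise_derivable_def map_space_cut_eq_iff act
  proof (intro ballI allI impI)
    fix g x and R :: real
    assume g: "g \<in> \<Gamma>" and R: "0 \<le> R"
      and eq: "\<forall>z\<in>cball x (R + (r + s)). \<psi> g *v code (isom_apply (isom_inv g) z) = code z"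
    show "cut S (act S g P) (cball x R) = cut S P (cball x R)"
    proof (rule patterns_agree_if_patches_agree[OF abstract_pattern_space_axioms gl
          act_closed[OF g P] component_radius_act[OF g P \<rho>] P \<rho> uniformly_discrete_D dense r(1)])
      fix p assume p: "p \<in> D" "dist x p \<le> R + r"
      have "\<psi> g *v code (isom_apply (isom_inv g) z) = code z" if "dist p z \<le> s" for z
        using eq p(2) that dist_triangle[of x z p] by simp
      then show "cut S (act S g P) (cball p r) = cut S P (cball p r)"
        using pattern_derivable[OF g _ p(1)] by (simp add: agree_on_def)
    qed
  qed
qed

text \<open>The radius \<open>r\<close> serves two purposes. The summand \<open>2 * L + R0\<close> makes the patches determine the
  points of \<open>D\<close> around them, and \<open>\<rho> + L\<close> makes the patches large enough to reconstruct the pattern.\<close>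

lemma ex_smooth_code:
  fixes \<Gamma> :: "('d::finite) isom set" and S :: "('p, real ^ 'd, 'd isom) pattern_space"
    and \<psi> :: "'d isom \<Rightarrow> complex ^ ('m::finite) ^ 'm"
  assumes S: "isometric_patterns \<Gamma> S" and T: "isometric_patterns \<Gamma> (map_space \<psi>)"
    and \<psi>: "\<And>g h. g \<in> \<Gamma> \<Longrightarrow> h \<in> \<Gamma> \<Longrightarrow> \<psi> (g \<odot> h) = \<psi> g ** \<psi> h" "\<And>g. g \<in> \<Gamma> \<Longrightarrow> invertible (\<psi> g)"
    and gl: "glueable S" and P: "P \<in> carrier S"
    and dd: "delone_deriving (isom_group \<Gamma>) isom_apply S P" and bc: "bounded_components S P"
  shows "\<exists>f\<in>smooth_maps \<psi>. mutually_locally_derivable (isom_group \<Gamma>) S P (map_space \<psi>) f"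
proof -
  interpret isometric_patterns \<Gamma> S by fact
  obtain \<rho> where \<rho>: "\<rho> > 0" "component_radius S P \<rho>"
    using bounded_components_radius[OF abstract_pattern_space_axioms P bc] .
  obtain D where D: "delone D" "locally_derivable (isom_group \<Gamma>) S P (UD_space isom_apply) D"
    using dd unfolding delone_deriving_def by blast
  have ud: "uniformly_discrete D" and rd: "relatively_dense D"
    using D(1) unfolding delone_def by simp_all
  obtain L where L: "L > 0" "\<And>x. \<exists>p\<in>D. dist x p < L"
    using rd unfolding relatively_dense_def by fastforce
  obtain s0 where s0: "s0 > 0" "\<And>p q. p \<in> D \<Longrightarrow> q \<in> D \<Longrightarrow> p \<noteq> q \<Longrightarrow> s0 < dist p q"
    using ud unfolding uniformly_discrete_def by blast
  define s where "s = min s0 L"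
  have s: "0 < s" "s \<le> L" "s \<le> s0" using s0(1) L(1) by (simp_all add: s_def)
  have UD: "isometric_patterns \<Gamma> (UD_space isom_apply)"
    using subgroup translation UD_over[OF subgroup]
    by (intro isometric_patterns.intro isometry_group.intro isometric_patterns_axioms.intro)
  have "D \<in> carrier (UD_space isom_apply)" using ud by (simp add: UD_space_def)
  then obtain R0 where R0: "R0 \<ge> 0" "pointwise_derivable \<Gamma> S P (UD_space isom_apply) D R0"
    using D(2) locally_derivable_iff_pointwise[OF S UD P] by blast
  define r where "r = 2 * L + R0 + \<rho>"
  interpret pattern_with_points \<Gamma> S P D s L r
  proof
    fix g x assume g: "g \<in> \<Gamma>" and ag: "agree_on (act S g P) P x r"
    have "agree_on (act S g P) P x (2 * L + R0)"
      using agree_on_smaller[OF ag act_closed[OF g P] P] \<rho>(1) by (simp add: r_def)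
    then show "isom_apply g ` D \<inter> cball x (2 * L) = D \<inter> cball x (2 * L)"
      using R0(2) g L(1) by (simp add: pointwise_derivable_def agree_on_def UD_space_def)
  qed (use P s s0 L in \<open>auto intro: le_less_trans\<close>)
  have "\<exists>y \<delta>. marker {g \<in> matching p. isom_apply g p = p} y \<delta> \<and> (\<forall>j. dist p (y j) < s / 8)" for p
    using finite_matching s(1) by (intro ex_marker) (auto dest: matchingD(1) intro: carrier)
  then have "\<forall>p. \<exists>y \<delta>. marker {g \<in> matching p. isom_apply g p = p} y \<delta> \<and> (\<forall>j. dist p (y j) < s / 8)"
    by (rule allI)
  then obtain y \<delta> where "\<forall>p. marker {g \<in> matching p. isom_apply g p = p} (y p) (\<delta> p) \<and> (\<forall>j. dist p (y p j) < s / 8)"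
    unfolding choice_iff by (elim exE)
  then have y: "\<And>p. marker {g \<in> matching p. isom_apply g p = p} (y p) (\<delta> p)"
      "\<And>p j. dist p (y p j) < s / 8"
    by simp_all
  define b where "b = (\<lambda>a :: (real ^ 'd) \<times> 'd option. min (\<delta> (fst a) / 2) (s / 8))"
  have "countable (D \<times> (UNIV :: 'd option set))"
    by (intro countable_SIGMA countable_D countableI_type)
  moreover have "0 < b a" for a
    using markerD(1)[OF y(1)] s(1) by (simp add: b_def)
  ultimately obtain rd' where rd': "inj_on rd' (D \<times> UNIV)"
     "\<forall>a\<in>D \<times> UNIV. 0 < rd' a \<and> rd' a < b a"
    using ex_injective_below[of "D \<times> UNIV" b] by blast
  define v :: "complex ^ 'm" where "v = (\<chi> i. 1)"
  interpret marked_pattern \<Gamma> S P D s L r y \<delta> "curry rd'" \<psi> v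
  proof
    show "v \<noteq> 0" by (simp add: v_def vec_eq_iff)
    show "p = p' \<and> j = j'" if "p \<in> D" "p' \<in> D" "curry rd' p j = curry rd' p' j'" for p p' j j'
      using inj_onD[OF rd'(1), of "(p, j)" "(p', j')"] that by simp
    show "0 < curry rd' p j" "curry rd' p j < \<delta> p / 2" "curry rd' p j < s / 8" if "p \<in> D" for p j
      using bspec[OF rd'(2), of "(p, j)"] that by (simp_all add: b_def)
  qed (use y \<psi> in blast)+
  have code: "code \<in> smooth_maps \<psi>"
    using code_smooth by (simp add: smooth_maps_def map_space_def)
  then have "code \<in> carrier (map_space \<psi>)" by (simp add: smooth_maps_def)
  moreover have r: "\<rho> + L \<le> r" "0 \<le> r" "0 \<le> r + s" using L(1) R0(1) \<rho>(1) s(1) by (simp_all add: r_def)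
  ultimately have "mutually_locally_derivable (isom_group \<Gamma>) S P (map_space \<psi>) code"
    unfolding mutually_locally_derivable_def
    using code_mutually_derivable[OF gl \<rho>(2) r(1,2)]
      locally_derivable_iff_pointwise[OF S T P] locally_derivable_iff_pointwise[OF T S _ P] by blast
  with code show ?thesis by blast
qed

lemma mutually_locally_derivable_if_same_smooth_maps:
  fixes \<psi> :: "('d::finite) isom \<Rightarrow> complex ^ ('m::finite) ^ 'm"
  assumes S: "isometric_patterns \<Gamma> S" and S': "isometric_patterns \<Gamma> S'" and T: "isometric_patterns \<Gamma> (map_space \<psi>)"
    and P: "P \<in> carrier S" and P': "P' \<in> carrier S'"
    and f: "f \<in> smooth_maps \<psi>" "mutually_locally_derivable (isom_group \<Gamma>) S P (map_space \<psi>) f"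
    and eq: "derivable_smooth_maps (isom_group \<Gamma>) \<psi> S P = derivable_smooth_maps (isom_group \<Gamma>) \<psi> S' P'"
  shows "locally_derivable (isom_group \<Gamma>) S' P' S P"
proof -
  have "f \<in> derivable_smooth_maps (isom_group \<Gamma>) \<psi> S P"
    using f by (simp add: derivable_smooth_maps_def mutually_locally_derivable_def)
  then have "locally_derivable (isom_group \<Gamma>) S' P' (map_space \<psi>) f"
    unfolding eq by (simp add: derivable_smooth_maps_def)
  moreover have "f \<in> carrier (map_space \<psi>)" using f(1) by (simp add: smooth_maps_def)
  ultimately show ?thesis
    using locally_derivable_trans[OF S' T S P' _ P] f(2) unfolding mutually_locally_derivable_def by blast
qed

lemma derivable_smooth_maps_mono:
  assumes "isometric_patterns \<Gamma> S" "isometric_patterns \<Gamma> S'" "isometric_patterns \<Gamma> (map_space \<psi>)"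
    and "P \<in> carrier S" "P' \<in> carrier S'" "locally_derivable (isom_group \<Gamma>) S' P' S P"
  shows "derivable_smooth_maps (isom_group \<Gamma>) \<psi> S P \<subseteq> derivable_smooth_maps (isom_group \<Gamma>) \<psi> S' P'"
  using locally_derivable_trans[OF assms(2,1,3,5,4) _ assms(6)]
  by (auto simp: derivable_smooth_maps_def smooth_maps_def)

theorem theorem5p11:
  fixes \<Gamma> :: "('d::finite) isom set"
    and \<phi> :: "'d isom \<Rightarrow> complex ^ ('m::finite) ^ 'm"
    and S :: "('p, real ^ 'd, 'd isom) pattern_space"
    and S' :: "('q, real ^ 'd, 'd isom) pattern_space"
    and P :: 'p and P' :: 'q
  assumes "subgroup \<Gamma> euclidean_group"
    and "closed \<Gamma>"
    and "\<And>a. (a, mat 1) \<in> \<Gamma>"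
    and "\<phi> \<in> hom (isom_group (isotropy \<Gamma>)) GL"
    and "(\<exists>v. v \<noteq> 0 \<and> (\<forall>\<gamma>\<in>isotropy \<Gamma>. \<phi> \<gamma> *v v = v)) \<or> finite (isotropy \<Gamma>)"
    and "abstract_pattern_space_over (isom_group \<Gamma>) isom_apply S"
    and "abstract_pattern_space_over (isom_group \<Gamma>) isom_apply S'"
    and "glueable S" and "glueable S'"
    and "P \<in> carrier S" and "P' \<in> carrier S'"
    and "delone_deriving (isom_group \<Gamma>) isom_apply S P"
    and "delone_deriving (isom_group \<Gamma>) isom_apply S' P'"
    and "bounded_components S P" and "bounded_components S' P'"
  shows "mutually_locally_derivable (isom_group \<Gamma>) S P S' P' \<longleftrightarrow>
         derivable_smooth_maps (isom_group \<Gamma>) (\<phi> \<circ> isom_proj) S P =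
         derivable_smooth_maps (isom_group \<Gamma>) (\<phi> \<circ> isom_proj) S' P'"
proof -
  let ?\<psi> = "\<phi> \<circ> isom_proj"
  have \<Gamma>: "isometry_group \<Gamma>" using assms(1,3) by (rule isometry_group.intro)
  have S: "isometric_patterns \<Gamma> S" and S': "isometric_patterns \<Gamma> S'"
    using \<Gamma> assms(6,7) by (simp_all add: isometric_patterns_def isometric_patterns_axioms_def)
  have T: "isometric_patterns \<Gamma> (map_space ?\<psi>)"
    using assms(1,3,4) by (rule map_space_isometric)
  note \<psi> = isotropy_hom(2,1)[OF \<Gamma> assms(4)]
  obtain f where f: "f \<in> smooth_maps ?\<psi>" "mutually_locally_derivable (isom_group \<Gamma>) S P (map_space ?\<psi>) f"
    using ex_smooth_code[OF S T \<psi> assms(8,10,12,14)] by blast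
  obtain f' where f': "f' \<in> smooth_maps ?\<psi>" "mutually_locally_derivable (isom_group \<Gamma>) S' P' (map_space ?\<psi>) f'"
    using ex_smooth_code[OF S' T \<psi> assms(9,11,13,15)] by blast
  show ?thesis
  proof
    assume "mutually_locally_derivable (isom_group \<Gamma>) S P S' P'"
    then show "derivable_smooth_maps (isom_group \<Gamma>) ?\<psi> S P = derivable_smooth_maps (isom_group \<Gamma>) ?\<psi> S' P'"
      using derivable_smooth_maps_mono[OF S S' T assms(10,11)]
        derivable_smooth_maps_mono[OF S' S T assms(11,10)]
      unfolding mutually_locally_derivable_def by blast
  next
    assume eq: "derivable_smooth_maps (isom_group \<Gamma>) ?\<psi> S P = derivable_smooth_maps (isom_group \<Gamma>) ?\<psi> S' P'"
    show "mutually_locally_derivable (isom_group \<Gamma>) S P S' P'"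
      unfolding mutually_locally_derivable_def
      using mutually_locally_derivable_if_same_smooth_maps[OF S S' T assms(10,11) f eq]
        mutually_locally_derivable_if_same_smooth_maps[OF S' S T assms(11,10) f' eq[symmetric]] by blast
  qed
qed

end
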